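(* Let $X$ and $Y$ be asymptotically coarse Lipschitz equivalent Banach spaces. If $X$ is AUSable, then $Y$ is AUSable.
   Context: For a Banach space $X$, $S_X$ is its unit sphere and $\mathrm{cof}(X)$ is the set of its closed finite codimensional subspaces. The modulus of asymptotic uniform smoothness of $X$ is $$\bar\rho_X(\tau)=\sup_{x\in S_X}\inf_{Y\in \mathrm{cof}(X)}\sup_{y\in S_Y}\|x+\tau y\|-1,\qquad \tau\ge 0.$$ $X$ is AUS (asymptotically uniformly smooth) if $\lim_{\tau\to0}\bar\rho_X(\tau)/\tau=0$. $X$ is AUSable if it admits an equivalent norm for which it is AUS. Banach spaces are regarded as metric spaces with the metric $d(x,x')=\|x-x'\|$. Let $(X,d)$ and $(Y,\partial)$ be metric spaces. A map $f:X\to Y$ is coarse Lipschitz if there is $L>0$ such that $\partial(f(x),f(x'))\le L\,d(x,x')+L$ for all $x,x'\in X$. Two maps $f,g:X\to Y$ are asymptotically close, written $f\sim_\infty g$, if for some $x_0\in X$ one has $\lim_{x\to\infty}\frac{\partial(f(x),g(x))}{d(x,x_0)}=0$, where $x\to\infty$ means $d(x,x_0)\to\infty$; if $X$ is bounded, any two maps $X\to Y$ are by convention asymptotically close. $X$ and $Y$ are asymptotically coarse Lipschitz equivalent if there are coarse Lipschitz maps $f:X\to Y$ and $g:Y\to X$ with $g\circ f\sim_\infty \mathrm{Id}_X$ and $f\circ g\sim_\infty \mathrm{Id}_Y$. *)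

theory Defs
  imports "HOL-Analysis.Analysis"
begin

definition is_norm :: "('a::real_vector \<Rightarrow> real) \<Rightarrow> bool" where
  "is_norm N \<longleftrightarrow>
     (\<forall>x. 0 \<le> N x) \<and> (\<forall>x. N x = 0 \<longleftrightarrow> x = 0) \<and>
     (\<forall>c x. N (c *\<^sub>R x) = \<bar>c\<bar> * N x) \<and> (\<forall>x y. N (x + y) \<le> N x + N y)"

definition equivalent_norm :: "('a::real_normed_vector \<Rightarrow> real) \<Rightarrow> bool" where
  "equivalent_norm N \<longleftrightarrow>
     is_norm N \<and> (\<exists>c>0. \<exists>C>0. \<forall>x. c * norm x \<le> N x \<and> N x \<le> C * norm x)"

definition norm_sphere :: "('a::real_vector \<Rightarrow> real) \<Rightarrow> 'a set \<Rightarrow> 'a set" where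
  "norm_sphere N Y = {y \<in> Y. N y = 1}"

definition finite_codim :: "'a::real_vector set \<Rightarrow> bool" where
  "finite_codim Y \<longleftrightarrow> (\<exists>B. finite B \<and> span (Y \<union> B) = UNIV)"

text \<open>Closedness refers to the topology of the type; any equivalent norm yields the same
  closed sets, so the family below is the right one for every equivalent norm.\<close>

definition cof :: "'a::real_normed_vector set set" where
  "cof = {Y. subspace Y \<and> closed Y \<and> finite_codim Y}"

text \<open>The modulus of asymptotic uniform smoothness of the space equipped with the
  (equivalent) norm \<open>N\<close>.  All suprema and infima over nonempty sets are of bounded sets of
  reals.  Since \<open>N (x + \<tau> y)\<close> and \<open>N (x - \<tau> y)\<close> average to at least \<open>N x = 1\<close>, the supremum over a
  nonempty sphere of \<open>Y\<close> is at least 1; over the empty sphere of \<open>Y = {0}\<close> it is taken to be 1,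
  so the modulus of a finite-dimensional space is 0, as usual.  The same value is
  assigned to the zero space.\<close>

definition aus_modulus :: "('a::real_normed_vector \<Rightarrow> real) \<Rightarrow> real \<Rightarrow> real" where
  "aus_modulus N \<tau> =
     (if norm_sphere N UNIV = {} then 0
      else (SUP x\<in>norm_sphere N UNIV. INF Y\<in>cof.
              (if norm_sphere N Y = {} then 1
               else SUP y\<in>norm_sphere N Y. N (x + \<tau> *\<^sub>R y))) - 1)"

definition AUS :: "('a::real_normed_vector \<Rightarrow> real) \<Rightarrow> bool" where
  "AUS N \<longleftrightarrow> ((\<lambda>\<tau>. aus_modulus N \<tau> / \<tau>) \<longlongrightarrow> 0) (at_right 0)"

definition AUSable :: "'a::banach itself \<Rightarrow> bool" where
  "AUSable _ \<longleftrightarrow> (\<exists>N :: 'a \<Rightarrow> real. equivalent_norm N \<and> AUS N)"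

definition coarse_lipschitz :: "('a::metric_space \<Rightarrow> 'b::metric_space) \<Rightarrow> bool" where
  "coarse_lipschitz f \<longleftrightarrow> (\<exists>L>0. \<forall>x x'. dist (f x) (f x') \<le> L * dist x x' + L)"

text \<open>The filter below expresses that the distance from \<open>x\<close> to \<open>x0\<close> tends to infinity.\<close>

definition asymptotically_close ::
    "('a::metric_space \<Rightarrow> 'b::metric_space) \<Rightarrow> ('a \<Rightarrow> 'b) \<Rightarrow> bool" where
  "asymptotically_close f g \<longleftrightarrow>
     bounded (UNIV :: 'a set) \<or>
     (\<exists>x0. ((\<lambda>x. dist (f x) (g x) / dist x x0) \<longlongrightarrow> 0)
              (filtercomap (\<lambda>x. dist x x0) at_top))"

definition asymptotically_coarse_lipschitz_equivalent ::
    "'a::metric_space itself \<Rightarrow> 'b::metric_space itself \<Rightarrow> bool" where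
  "asymptotically_coarse_lipschitz_equivalent _ _ \<longleftrightarrow>
     (\<exists>(f :: 'a \<Rightarrow> 'b) (g :: 'b \<Rightarrow> 'a).
        coarse_lipschitz f \<and> coarse_lipschitz g \<and>
        asymptotically_close (g \<circ> f) id \<and> asymptotically_close (f \<circ> g) id)"

end

theory Submission
  imports Defs
begin

text \<open>Let \<open>f\<close> and \<open>g\<close> be the two coarse Lipschitz maps. A functional \<open>u\<close> on the target is
  measured by its norm plus a weighted sum of the quantities
  \<open>\<sigma> u = sup u(f x - f y) / \<parallel>x - y\<parallel>\<close>, where each supremum runs over pairs at distance at least \<open>s\<close>
  and within \<open>R \<parallel>x - y\<parallel>\<close> of the origin, and \<open>(R, s)\<close> runs over a countable family. If a pair almost
  attains a supremum that does not drop much at the next scale, then \<open>f\<close> is almost affine in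
  direction \<open>u\<close> between \<open>x\<close> and \<open>y\<close>: moving the midpoint by \<open>z\<close> in a suitable finite-codimensional
  subspace hardly changes the distances, by smoothness of the source, hence hardly changes \<open>u(f z)\<close>.
  By Gorelik's principle such \<open>z\<close> can be chosen with \<open>f z\<close> pointing, up to a finite set and a small
  error, in any given direction of comparable length; so a functional \<open>\<phi>\<close> weakly close to \<open>u\<close> but
  far from it in norm has a strictly larger \<open>\<sigma>\<close>. Among finitely many nested scales one
  must have a small drop, so the sum gains a fixed amount. The predual of this norm is AUS. For maps that are only
  asymptotically inverse to each other, the bound \<open>R\<close> on the distance to the origin keeps the errors
  negligible, and since a midpoint worsens it by a constant factor, all \<open>R = 8^a / c\<close> are needed.\<close>

section \<open>Brouwer's theorem for cubes of varying dimension\<close>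

text \<open>What makes the new norm AUS is a property of its dual: a functional weakly approached by
  functionals of the dual ball that stay \<epsilon>-separated from it has dual norm at most
  \<open>1 - h\<close>, with one \<open>h\<close> for all such functionals. Suprema over sets of
  slopes are weak-star lower semicontinuous, so a dual norm built from them has a predual norm.

  The uniformity of \<open>h\<close> is the obstacle. A near-extremal pair is taken from a smaller
  family, since its halves are only known to lie in the next larger one, and it is useful only if
  the supremum over the larger family is hardly bigger. All suprema lie between 0 and
  \<open>L / c + L\<close>, so a number of scales fixed in advance contains such a step for every
  functional; which step it is depends on the functional, so one norm has to carry all scales.

  For a pair at distance \<open>2 * D\<close> whose midpoint moves by \<open>b * D\<close>, gain and
  loss are both of order \<open>b * D\<close>: the separated functional gains \<beta> times that,
  the lengthening of the halves costs only \<theta> times that, and asymptotic smoothness lets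
  \<theta> be chosen after \<beta>.\<close>

lemma compact_pointwise:
  fixes S :: "'i \<Rightarrow> 'b::topological_space set"
  assumes "\<And>i. compact (S i)"
  shows "compact {x. \<forall>i. x i \<in> S i}"
proof -
  have "compactin (product_topology (\<lambda>i. euclidean) UNIV) (PiE UNIV S)"
    using assms by (simp add: compactin_PiE)
  moreover have "PiE UNIV S = {x. \<forall>i. x i \<in> S i}" by auto
  ultimately show ?thesis
    by (simp add: euclidean_product_topology)
qed

lemma tendsto_pointwise_iff:
  fixes l :: "'i \<Rightarrow> 'b::topological_space"
  shows "(f \<longlongrightarrow> l) F \<longleftrightarrow> (\<forall>i. ((\<lambda>n. f n i) \<longlongrightarrow> l i) F)"
  using limitin_componentwise[of "\<lambda>i. euclidean" UNIV f l F]
  by (simp add: euclidean_product_topology)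

text \<open>The dimension is a natural number rather than a type, because it will be the codimension
  of a subspace met inside a proof; coordinates from \<open>n\<close> on are pinned to 0. Kuhn's
  combinatorial lemma on grids of mesh \<open>1 / Suc p\<close> gives cells in which every
  coordinate of \<open>f x - x\<close> takes both weak signs, and these cells shrink to a fixed
  point along a subsequence.\<close>

lemma brouwer_nat_cube:
  fixes f :: "(nat \<Rightarrow> real) \<Rightarrow> nat \<Rightarrow> real" and n :: nat
  defines "Q \<equiv> {x. \<forall>i. x i \<in> (if i < n then {0..1} else {0})}"
  assumes cont: "continuous_on Q f" and maps: "\<And>x. x \<in> Q \<Longrightarrow> f x \<in> Q"
  obtains x where "x \<in> Q" "f x = x"
proof -
  define pt where "pt p x i = (if i < n then real (x i) / real p else 0)"
    for p :: nat and x :: "nat \<Rightarrow> nat" and i :: nat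
  have ptQ: "pt p x \<in> Q" if "\<forall>i<n. x i \<le> p" for p x
    using that by (auto simp: pt_def Q_def divide_le_eq_1)
  define near where "near q r \<longleftrightarrow> (\<forall>j<n. q j \<le> r j \<and> r j \<le> q j + 1)" for q r :: "nat \<Rightarrow> nat"
  define good where "good p q i r s \<longleftrightarrow> near q r \<and> near q s \<and>
       pt (Suc p) r i \<le> f (pt (Suc p) r) i \<and> f (pt (Suc p) s) i \<le> pt (Suc p) s i" for p q i r s
  have ex: "\<exists>q. (\<forall>i<n. q i < Suc p) \<and> (\<forall>i<n. \<exists>r s. good p q i r s)" for p
  proof -
    let ?p = "Suc p"
    \<comment> \<open>Kuhn's lemma dictates the labels on opposite faces. There they still tell the
      weak sign of \<open>f x i - x i\<close>, since \<open>f\<close> maps into the cube;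
      \<open>L0\<close> and \<open>L1\<close> check this.\<close>
    define label where "label x i = (if x i = 0 then 0 else if x i = ?p then 1
        else if pt ?p x i \<le> f (pt ?p x) i then 0 else (1::nat))" for x i
    obtain q where q: "\<forall>i<n. q i < ?p"
      and rs: "\<forall>i<n. \<exists>r s. near q r \<and> near q s \<and> label r i \<noteq> label s i"
      unfolding near_def by (rule kuhn_lemma[of ?p n label]) (auto simp: label_def)
    have L0: "pt ?p x i \<le> f (pt ?p x) i" if "near q x" "i < n" "label x i = 0" for x i
    proof -
      have "\<forall>i<n. x i \<le> ?p" using that(1) q unfolding near_def
        by (metis Suc_eq_plus1 Suc_leI le_trans not_less_eq_eq)
      then have "f (pt ?p x) \<in> Q" using maps ptQ by blast
      then have "0 \<le> f (pt ?p x) i" using that(2) by (auto simp: Q_def dest!: spec[of _ i])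
      then show ?thesis using that by (auto simp: label_def pt_def split: if_splits)
    qed
    have L1: "f (pt ?p x) i \<le> pt ?p x i" if "near q x" "i < n" "label x i \<noteq> 0" for x i
    proof -
      have "\<forall>i<n. x i \<le> ?p" using that(1) q unfolding near_def
        by (metis Suc_eq_plus1 Suc_leI le_trans not_less_eq_eq)
      then have "f (pt ?p x) \<in> Q" using maps ptQ by blast
      then have "f (pt ?p x) i \<le> 1" using that(2) by (auto simp: Q_def dest!: spec[of _ i])
      then show ?thesis using that by (auto simp: label_def pt_def simp del: of_nat_Suc split: if_splits)
    qed
    have "\<exists>r s. good p q i r s" if i: "i < n" for i
    proof -
      obtain r s where rs': "near q r" "near q s" "label r i \<noteq> label s i"
        using rs i by blast
      show ?thesis
      proof (cases "label r i = 0")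
        case True
        then show ?thesis using L0[of r i] L1[of s i] rs' i
          unfolding good_def by (intro exI[of _ r] exI[of _ s]) auto
      next
        case False
        moreover have "label s i = 0" using False rs' by (auto simp: label_def split: if_splits)
        ultimately show ?thesis using L0[of s i] L1[of r i] rs' i
          unfolding good_def by (intro exI[of _ s] exI[of _ r]) auto
      qed
    qed
    then show ?thesis using q by blast
  qed
  obtain q where q: "\<And>p i. i < n \<Longrightarrow> q p i < Suc p"
    and "\<And>p i. i < n \<Longrightarrow> \<exists>r s. good p (q p) i r s"
    using ex by metis
  then have "\<forall>p i. \<exists>r s. i < n \<longrightarrow> good p (q p) i r s" by blast
  then obtain r s where rs: "\<And>p i. i < n \<Longrightarrow> good p (q p) i (r p i) (s p i)"
    by metis
  have "compact Q" unfolding Q_def by (rule compact_pointwise) auto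
  then have "seq_compact Q" by (rule compact_imp_seq_compact)
  moreover have "\<forall>p. pt (Suc p) (q p) \<in> Q" by (intro allI ptQ) (use q in \<open>auto simp: less_imp_le\<close>)
  ultimately obtain x h where x: "x \<in> Q" and h: "strict_mono h"
    and lim: "((\<lambda>p. pt (Suc p) (q p)) \<circ> h) \<longlonglongrightarrow> x"
    unfolding seq_compact_def by metis
  have near_lim: "(\<lambda>k. pt (Suc (h k)) (w (h k))) \<longlonglongrightarrow> x" if w: "\<And>p. near (q p) (w p)" for w
    unfolding tendsto_pointwise_iff
  proof
    fix j
    have a: "(\<lambda>k. pt (Suc (h k)) (q (h k)) j) \<longlonglongrightarrow> x j"
      using lim unfolding tendsto_pointwise_iff by (simp add: o_def)
    have b: "(\<lambda>k. 1 / real (Suc (h k))) \<longlonglongrightarrow> 0"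
      using LIMSEQ_subseq_LIMSEQ[OF LIMSEQ_Suc[OF lim_1_over_n] h] by (simp add: o_def)
    have c: "(\<lambda>k. pt (Suc (h k)) (q (h k)) j + 1 / real (Suc (h k))) \<longlonglongrightarrow> x j"
      using tendsto_add[OF a b] by simp
    show "(\<lambda>k. pt (Suc (h k)) (w (h k)) j) \<longlonglongrightarrow> x j"
    proof (rule tendsto_sandwich[OF _ _ a c]; rule always_eventually; rule allI)
      fix k
      show "pt (Suc (h k)) (q (h k)) j \<le> pt (Suc (h k)) (w (h k)) j"
        using w[of "h k"] by (auto simp: near_def pt_def intro!: divide_right_mono)
      show "pt (Suc (h k)) (w (h k)) j \<le> pt (Suc (h k)) (q (h k)) j + 1 / real (Suc (h k))"
      proof (cases "j < n")
        case True
        then have "real (w (h k) j) \<le> real (q (h k) j) + 1"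
          using w[of "h k"] by (auto simp: near_def simp flip: of_nat_Suc)
        then show ?thesis using True
          by (auto simp: pt_def simp flip: add_divide_distrib simp del: of_nat_Suc intro!: divide_right_mono)
      qed (auto simp: pt_def)
    qed
  qed
  have inQ: "pt (Suc (h k)) (w (h k)) \<in> Q" if "\<And>p. near (q p) (w p)" for w k
  proof (rule ptQ, intro allI impI)
    fix i assume "i < n"
    then show "w (h k) i \<le> Suc (h k)" using that[of "h k"] q[of i "h k"] by (auto simp: near_def)
  qed
  have flim: "(\<lambda>k. f (pt (Suc (h k)) (w (h k))) i) \<longlonglongrightarrow> f x i" if w: "\<And>p. near (q p) (w p)" for w i
    using continuous_on_tendsto_compose[OF cont near_lim[OF w] x] inQ[OF w]
    by (simp add: tendsto_pointwise_iff)
  have "f x i = x i" for i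
  proof (cases "i < n")
    case True
    have nr: "near (q p) (r p i)" and ns: "near (q p) (s p i)" for p
      using rs[OF True, of p] by (auto simp: good_def)
    have "x i \<le> f x i"
      by (rule LIMSEQ_le[OF near_lim[OF nr, unfolded tendsto_pointwise_iff, THEN spec, of i] flim[OF nr]])
         (use rs[OF True] in \<open>auto simp: good_def\<close>)
    moreover have "f x i \<le> x i"
      by (rule LIMSEQ_le[OF flim[OF ns] near_lim[OF ns, unfolded tendsto_pointwise_iff, THEN spec, of i]])
         (use rs[OF True] in \<open>auto simp: good_def\<close>)
    ultimately show ?thesis by simp
  next
    case False
    then show ?thesis using x maps[OF x] unfolding Q_def by (auto dest!: spec[of _ i])
  qed
  then show ?thesis using that x by blast
qed

section \<open>Norming functionals\<close>

definition sublinear :: "('a::real_vector \<Rightarrow> real) \<Rightarrow> bool" where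
  "sublinear q \<longleftrightarrow> (\<forall>x y. q (x + y) \<le> q x + q y) \<and> (\<forall>t\<ge>0. \<forall>x. q (t *\<^sub>R x) = t * q x)"

text \<open>The assumptions \<open>sub\<close> and \<open>hom\<close> say that the family is
  directed enough for its infimum to stay sublinear; they cover both the rays of
  \<open>sublinear_ray\<close> and the chains in Zorn's lemma. The bound \<open>lb\<close> keeps the
  infima finite.\<close>

lemma sublinear_INF:
  assumes "sublinear q" and ne: "I \<noteq> {}"
  and h: "\<And>i x. i \<in> I \<Longrightarrow> lb x \<le> h i x"
  and sub: "\<And>i j x y. i \<in> I \<Longrightarrow> j \<in> I \<Longrightarrow> \<exists>k\<in>I. h k (x + y) \<le> h i x + h j y"
  and hom: "\<And>i t x. i \<in> I \<Longrightarrow> 0 < t \<Longrightarrow> \<exists>k\<in>I. h k (t *\<^sub>R x) \<le> t * h i x"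
  and zero: "\<And>i. i \<in> I \<Longrightarrow> h i 0 = 0"
  shows "sublinear (\<lambda>x::'a::real_vector. INF i\<in>I. (h i x :: real))"
proof -
  let ?q = "\<lambda>x. INF i\<in>I. h i x"
  have bdd: "bdd_below ((\<lambda>i. h i x) ` I)" for x using h by (auto simp: bdd_below_def)
  have low: "?q x \<le> h i x" if "i \<in> I" for i x by (rule cINF_lower[OF bdd that])
  have add: "?q (x + y) \<le> ?q x + ?q y" for x y
  proof -
    have "?q (x + y) \<le> h i x + h j y" if "i \<in> I" "j \<in> I" for i j
      using sub[OF that] low by (meson order_trans)
    then have "?q (x+y) - h i x \<le> h j y" if "i \<in> I" "j \<in> I" for i j
      using that by (simp add: diff_le_eq add.commute)
    then have "?q (x+y) - h i x \<le> ?q y" if "i \<in> I" for i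
      using that ne by (intro cINF_greatest)
    then have "?q (x+y) - ?q y \<le> h i x" if "i \<in> I" for i
      using that by (simp add: diff_le_eq add.commute)
    then have "?q (x+y) - ?q y \<le> ?q x"
      using ne by (intro cINF_greatest)
    then show ?thesis by simp
  qed
  have le: "?q (t *\<^sub>R x) \<le> t * ?q x" if t: "0 < t" for t x
  proof -
    have "?q (t *\<^sub>R x) / t \<le> h i x" if i: "i \<in> I" for i
    proof -
      obtain k where "k \<in> I" "h k (t *\<^sub>R x) \<le> t * h i x" using hom[OF i t] by blast
      then have "?q (t *\<^sub>R x) \<le> t * h i x" using low order_trans by blast
      then show ?thesis using t by (simp add: divide_le_eq mult.commute)
    qed
    then have "?q (t *\<^sub>R x) / t \<le> ?q x" using ne by (intro cINF_greatest) auto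
    then show ?thesis using t by (simp add: divide_le_eq mult.commute)
  qed
  have "?q (t *\<^sub>R x) = t * ?q x" if "0 \<le> t" for t x
  proof (cases "t = 0")
    case True then show ?thesis using zero ne by (simp cong: INF_cong_simp)
  next
    case False
    then have t: "0 < t" using that by simp
    have "?q x \<le> inverse t * ?q (t *\<^sub>R x)" using le[of "inverse t" "t *\<^sub>R x"] t by simp
    then have "t * ?q x \<le> ?q (t *\<^sub>R x)" using t by (simp add: field_simps)
    then show ?thesis using le[OF t, of x] by simp
  qed
  then show ?thesis using add unfolding sublinear_def by blast
qed

lemma sublinear_0: "sublinear q \<Longrightarrow> q 0 = 0"
  unfolding sublinear_def by (metis mult_zero_left order_refl scale_zero_left)

lemma sublinear_minus: "sublinear q \<Longrightarrow> - q (- x) \<le> q x"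
  using sublinear_0[of q] unfolding sublinear_def by (metis add.right_inverse minus_le_iff add_le_cancel_left neg_le_iff_le add.commute diff_0 le_diff_eq)

text \<open>This is the lowering step behind Hahn-Banach: the new functional lies below
  \<open>q\<close> (take \<open>t = 0\<close>) and is at most \<open>- q a\<close> at
  \<open>- a\<close> (take \<open>t = 1\<close>), so a linear functional below it agrees with
  \<open>q\<close> at \<open>a\<close>.\<close>

lemma sublinear_ray:
  assumes "sublinear q"
  shows "sublinear (\<lambda>x. INF t\<in>{0..}. q (x + t *\<^sub>R a) - t * q a)"
proof (rule sublinear_INF[OF assms, where lb = "\<lambda>x. - q (- x)"])
  have add: "q (x + y) \<le> q x + q y" and hom: "0 \<le> t \<Longrightarrow> q (t *\<^sub>R x) = t * q x" for x y t
    using assms by (auto simp: sublinear_def)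
  show "- q (- x) \<le> q (x + t *\<^sub>R a) - t * q a" if "t \<in> {0..}" for t x
    using add[of "- x" "x + t *\<^sub>R a"] hom[of t a] that by simp
  show "\<exists>k\<in>{0..}. q (x + y + k *\<^sub>R a) - k * q a \<le> q (x + i *\<^sub>R a) - i * q a + (q (y + j *\<^sub>R a) - j * q a)"
    if "i \<in> {0..}" "j \<in> {0..}" for i j x y
    using add[of "x + i *\<^sub>R a" "y + j *\<^sub>R a"] that
    by (intro bexI[of _ "i + j"]) (auto simp: algebra_simps)
  show "\<exists>k\<in>{0..}. q (t *\<^sub>R x + k *\<^sub>R a) - k * q a \<le> t * (q (x + i *\<^sub>R a) - i * q a)"
    if "i \<in> {0..}" "0 < t" for i t x
    using hom[of t "x + i *\<^sub>R a"] that
    by (intro bexI[of _ "t * i"]) (auto simp: algebra_simps)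
  show "q (0 + i *\<^sub>R a) - i * q a = 0" if "i \<in> {0..}" for i using hom that by simp
qed auto

lemma sublinear_ray_le:
  assumes "sublinear q" "0 \<le> t"
  shows "(INF t\<in>{0..}. q (x + t *\<^sub>R a) - t * q a) \<le> q (x + t *\<^sub>R a) - t * q a"
proof (rule cINF_lower)
  have "- q (- x) \<le> q (x + t *\<^sub>R a) - t * q a" if "t \<in> {0..}" for t
    using assms that unfolding sublinear_def by (smt (verit) add_minus_cancel atLeast_iff add.commute minus_add_cancel)
  then show "bdd_below ((\<lambda>t. q (x + t *\<^sub>R a) - t * q a) ` {0..})" by (auto simp: bdd_below_def)
qed (use assms in auto)

text \<open>A minimal sublinear functional is linear, because it cannot drop when it is
  replaced by its infimum along a ray.\<close>

lemma sublinear_dominates_linear: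
  fixes q :: "'a::real_vector \<Rightarrow> real"
  assumes q: "sublinear q"
  obtains \<phi> where "linear \<phi>" "\<And>x. \<phi> x \<le> q x"
proof -
  define A where "A = {p. sublinear p \<and> (\<forall>x. p x \<le> q x)}"
  have lb: "- q (- x) \<le> p x" if "p \<in> A" for p x
    using that sublinear_minus[of p x] unfolding A_def by (smt (verit, best) mem_Collect_eq)
  have "\<exists>m\<in>A. \<forall>p\<in>A. (\<forall>x. p x \<le> m x) \<longrightarrow> p = m"
  \<comment> \<open>The pointwise order is reversed, so that the maximal element delivered by Zorn's
    lemma is a minimal sublinear functional.\<close>
  proof (rule predicate_Zorn)
    show "partial_order_on A (relation_of (\<lambda>a b. \<forall>x. b x \<le> a x) A)"
      by (rule partial_order_on_relation_ofI) (auto intro: order_trans simp: fun_eq_iff intro!: antisym)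
    fix C assume C: "C \<in> Chains (relation_of (\<lambda>a b. \<forall>x. b x \<le> a x) A)"
    then have CA: "C \<subseteq> A" by (auto simp: Chains_def relation_of_def)
    have tot: "(\<forall>x. p x \<le> p' x) \<or> (\<forall>x. p' x \<le> p x)" if "p \<in> C" "p' \<in> C" for p p'
      using C that by (auto simp: Chains_def relation_of_def)
    show "\<exists>u\<in>A. \<forall>a\<in>C. \<forall>x. u x \<le> a x"
    proof (cases "C = {}")
      case True then show ?thesis using q unfolding A_def by auto
    next
      case False
      have low: "(INF p\<in>C. p x) \<le> p x" if "p \<in> C" for p x
        by (rule cINF_lower) (use lb CA that in \<open>auto simp: bdd_below_def\<close>)
      have "sublinear (\<lambda>x. INF p\<in>C. p x)"
      proof (rule sublinear_INF[OF q False, where lb = "\<lambda>x. - q (- x)"])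
        show "\<exists>k\<in>C. k (x + y) \<le> i x + j y" if ij: "i \<in> C" "j \<in> C" for i j x y
        proof -
          have "sublinear i" "sublinear j" using ij CA A_def by auto
          then show ?thesis using tot[OF ij] ij unfolding sublinear_def
            by (smt (verit, best))
        qed
        show "\<exists>k\<in>C. k (t *\<^sub>R x) \<le> t * i x" if "i \<in> C" "0 < t" for i t x
          using that CA unfolding A_def sublinear_def by (intro bexI[of _ i]) auto
        show "i 0 = 0" if "i \<in> C" for i using that CA sublinear_0 unfolding A_def by auto
      qed (use CA lb in auto)
      moreover have "(INF p\<in>C. p x) \<le> q x" for x
      proof -
        obtain p where "p \<in> C" using False by auto
        then show ?thesis using low[of p x] CA unfolding A_def by (smt (verit) mem_Collect_eq subsetD)
      qed
      ultimately have "(\<lambda>x. INF p\<in>C. p x) \<in> A" unfolding A_def by auto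
      then show ?thesis by (rule rev_bexI) (use low in blast)
    qed
  qed
  then obtain m where m: "m \<in> A" and min: "\<And>p. p \<in> A \<Longrightarrow> (\<And>x. p x \<le> m x) \<Longrightarrow> p = m" by blast
  have sm: "sublinear m" and mq: "m x \<le> q x" for x using m by (auto simp: A_def)
  have eq: "(\<lambda>x. INF t\<in>{0..}. m (x + t *\<^sub>R a) - t * m a) = m" for a
  proof (rule min)
    show le: "(INF t\<in>{0..}. m (x + t *\<^sub>R a) - t * m a) \<le> m x" for x
      using sublinear_ray_le[OF sm, of 0 x a] by simp
    show "(\<lambda>x. INF t\<in>{0..}. m (x + t *\<^sub>R a) - t * m a) \<in> A"
      unfolding A_def using sublinear_ray[OF sm, of a] le mq by (auto intro: order_trans)
  qed
  have "m x \<le> m (x + a) - m a" for x a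
    using sublinear_ray_le[OF sm, of 1 x a] fun_cong[OF eq[of a], of x] by simp
  then have add: "m (x + a) = m x + m a" for x a
    using sm unfolding sublinear_def by (smt (verit))
  have neg: "m (- x) = - m x" for x using add[of x "- x"] sublinear_0[OF sm] by simp
  have "m (t *\<^sub>R x) = t *\<^sub>R m x" for t x
  proof (cases "t \<ge> 0")
    case True then show ?thesis using sm by (simp add: sublinear_def)
  next
    case False
    then have "m ((- t) *\<^sub>R x) = (- t) * m x"
      using sm[unfolded sublinear_def, THEN conjunct2, rule_format, of "- t" x] by linarith
    then show ?thesis using neg[of "t *\<^sub>R x"] by simp
  qed
  then have "linear m" using add by (intro linearI)
  then show ?thesis using that mq by blast
qed

lemma norming_functional:
  fixes a :: "'a::real_normed_vector"
  obtains \<phi> where "linear \<phi>" "\<And>x. \<phi> x \<le> norm x" "\<phi> a = norm a"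
proof -
  have sn: "sublinear (norm :: 'a \<Rightarrow> real)" by (auto simp: sublinear_def norm_triangle_ineq)
  define q where "q x = (INF t\<in>{0..}. norm (x + t *\<^sub>R a) - t * norm a)" for x
  have "sublinear q" unfolding q_def by (rule sublinear_ray[OF sn])
  then obtain \<phi> where \<phi>: "linear \<phi>" "\<And>x. \<phi> x \<le> q x" using sublinear_dominates_linear by metis
  have le: "q x \<le> norm x" for x using sublinear_ray_le[OF sn, of 0 x a] by (simp add: q_def)
  have "q (- a) \<le> - norm a" using sublinear_ray_le[OF sn, of 1 "- a" a] by (simp add: q_def)
  then have "- \<phi> a \<le> - norm a" using \<phi>(2)[of "- a"] linear_neg[OF \<phi>(1), of a] by simp
  moreover have "\<phi> x \<le> norm x" for x using le \<phi>(2) order_trans by blast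
  ultimately show ?thesis using that[of \<phi>] \<phi>(1) by (metis antisym neg_le_iff_le)
qed

section \<open>Finite-codimensional subspaces and the Gorelik principle\<close>

text \<open>Normalised sums of the bumps \<open>w t\<close> over a finite subcover. \<open>T\<close>
  is chosen before \<open>h\<close>, so finitely many points serve every map \<open>h\<close>. As
  \<open>s x\<close> averages only values of \<open>h\<close> at points whose bump is active at
  \<open>x\<close>, an arbitrary map is replaced by a continuous one at the price of its local
  oscillation.\<close>

lemma compact_partition_of_unity:
  fixes K :: "'k::topological_space set" and w :: "'k \<Rightarrow> 'k \<Rightarrow> real"
  assumes "compact K" and cont: "\<And>k. k \<in> K \<Longrightarrow> continuous_on K (w k)"
    and pos: "\<And>k. k \<in> K \<Longrightarrow> 0 < w k k" and nonneg: "\<And>k x. 0 \<le> w k x"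
  obtains T where "finite T" "T \<subseteq> K"
    "\<And>h :: 'k \<Rightarrow> 'a::real_normed_vector. \<exists>s. continuous_on K s \<and>
        (\<forall>x\<in>K. s x \<in> convex hull (h ` {t \<in> T. 0 < w t x}))"
proof -
  have "\<exists>U. open U \<and> U \<inter> K = w k -` {0<..} \<inter> K" if "k \<in> K" for k
    using cont[OF that] unfolding continuous_on_open_invariant by auto
  then obtain U where U: "\<And>k. k \<in> K \<Longrightarrow> open (U k)"
    and UK: "\<And>k. k \<in> K \<Longrightarrow> U k \<inter> K = w k -` {0<..} \<inter> K" by metis
  have "K \<subseteq> (\<Union>k\<in>K. U k)" using UK pos by blast
  then obtain T where T: "T \<subseteq> K" "finite T" "K \<subseteq> (\<Union>k\<in>T. U k)"
    using compactE_image[OF assms(1), of K U] U by metis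
  define W where "W x = (\<Sum>t\<in>T. w t x)" for x
  have Wpos: "0 < W x" if x: "x \<in> K" for x
  proof -
    obtain t where t: "t \<in> T" "x \<in> U t" using T x by blast
    then have "0 < w t x" using UK[of t] T x by auto
    then show ?thesis unfolding W_def using T t nonneg by (intro sum_pos2) auto
  qed
  have "\<exists>s. continuous_on K s \<and> (\<forall>x\<in>K. s x \<in> convex hull (h ` {t \<in> T. 0 < w t x}))"
    for h :: "'k \<Rightarrow> 'a"
  proof (intro exI conjI ballI)
    let ?s = "\<lambda>x. \<Sum>t\<in>T. (w t x / W x) *\<^sub>R h t"
    show "continuous_on K ?s"
      unfolding W_def using T Wpos cont
      by (intro continuous_intros) (force simp: W_def)+
    fix x assume x: "x \<in> K"
    let ?P = "{t \<in> T. 0 < w t x}"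
    have eq: "?s x = (\<Sum>t\<in>?P. (w t x / W x) *\<^sub>R h t)"
      using T nonneg[of _ x] by (intro sum.mono_neutral_right) (auto simp: less_le)
    have "W x = (\<Sum>t\<in>?P. w t x)"
      unfolding W_def using T nonneg[of _ x] by (intro sum.mono_neutral_right) (auto simp: less_le)
    then have "(\<Sum>t\<in>?P. w t x / W x) = 1" using Wpos[OF x] by (simp flip: sum_divide_distrib)
    then show "?s x \<in> convex hull (h ` ?P)"
      unfolding eq using T Wpos[OF x]
      by (intro convex_sum[OF _ convex_convex_hull]) (auto intro!: hull_inc)
  qed
  then show ?thesis using that T by blast
qed

section \<open>Distance to a subspace as the quotient seminorm, and coordinates in the
  quotient\<close>

context
  fixes V :: "'a::real_normed_vector set"
  assumes V: "subspace V"
begin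

lemma infdist_less_subspace:
  assumes "infdist x V < d"
  obtains v where "v \<in> V" "norm (x - v) < d"
proof -
  have ne: "V \<noteq> {}" using subspace_0[OF V] by auto
  then have "(INF v\<in>V. dist x v) < d" using assms by (simp add: infdist_notempty)
  then obtain v where "v \<in> V" "dist x v < d" using ne
    by (subst (asm) cINF_less_iff) (auto intro: bdd_belowI[of _ 0])
  then show ?thesis using that by (simp add: dist_norm)
qed

lemma infdist_add_le: "infdist (x + y) V \<le> infdist x V + infdist y V"
proof (rule field_le_epsilon)
  fix e :: real assume "0 < e"
  obtain v where v: "v \<in> V" "norm (x - v) < infdist x V + e/2"
    using infdist_less_subspace[of x "infdist x V + e/2"] \<open>0 < e\<close> by auto
  obtain w where w: "w \<in> V" "norm (y - w) < infdist y V + e/2"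
    using infdist_less_subspace[of y "infdist y V + e/2"] \<open>0 < e\<close> by auto
  have "infdist (x + y) V \<le> dist (x + y) (v + w)"
    using v w V by (intro infdist_le subspace_add)
  also have "\<dots> \<le> norm (x - v) + norm (y - w)"
    by (metis add_diff_add dist_norm norm_triangle_ineq)
  finally show "infdist (x + y) V \<le> infdist x V + infdist y V + e" using v w by simp
qed

lemma infdist_scaleR_subspace: "infdist (c *\<^sub>R x) V = \<bar>c\<bar> * infdist x V"
proof -
  have le: "infdist (c *\<^sub>R x) V \<le> \<bar>c\<bar> * infdist x V" if "c \<noteq> 0" for c x
  proof (rule dense_ge)
    fix d assume d: "\<bar>c\<bar> * infdist x V < d"
    then have "infdist x V < d / \<bar>c\<bar>" using that by (simp add: field_simps)
    then obtain v where v: "v \<in> V" "norm (x - v) < d / \<bar>c\<bar>" by (rule infdist_less_subspace)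
    have "infdist (c *\<^sub>R x) V \<le> dist (c *\<^sub>R x) (c *\<^sub>R v)" using v V by (intro infdist_le subspace_scale)
    also have "\<dots> = \<bar>c\<bar> * norm (x - v)" by (simp add: dist_norm flip: scaleR_diff_right)
    also have "\<dots> \<le> d" using v that by (simp add: field_simps)
    finally show "infdist (c *\<^sub>R x) V \<le> d" .
  qed
  show ?thesis
  proof (cases "c = 0")
    case True then show ?thesis using subspace_0[OF V] by (simp add: infdist_zero)
  next
    case False
    have "infdist x V \<le> \<bar>inverse c\<bar> * infdist (c *\<^sub>R x) V" using le[of "inverse c" "c *\<^sub>R x"] False by simp
    then have "\<bar>c\<bar> * infdist x V \<le> infdist (c *\<^sub>R x) V" using False by (simp add: field_simps abs_inverse)
    then show ?thesis using le[OF False] by (simp add: antisym)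
  qed
qed

lemma infdist_le_norm_subspace: "infdist x V \<le> norm x"
  using infdist_le[OF subspace_0[OF V], of x] by simp

lemma infdist_subspace_minus: "infdist (- x) V = infdist x V"
  using infdist_scaleR_subspace[of "-1" x] by simp

lemma infdist_diff_le: "infdist (x - y) V \<le> infdist x V + infdist y V"
  using infdist_add_le[of x "- y"] infdist_subspace_minus by simp

lemma infdist_add_subspace: "v \<in> V \<Longrightarrow> infdist (x + v) V = infdist x V"
  using infdist_add_le[of x v] infdist_diff_le[of "x + v" v] by simp

lemma infdist_diff_subspace: "v \<in> V \<Longrightarrow> infdist (x - v) V = infdist x V"
  using infdist_add_subspace[of "- v" x] subspace_neg[OF V] by simp

lemma convex_infdist_subspace: "convex {z. infdist (z - a) V \<le> d}"
proof (rule convexI)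
  fix x y and u v :: real
  assume xy: "x \<in> {z. infdist (z - a) V \<le> d}" "y \<in> {z. infdist (z - a) V \<le> d}"
    and uv: "0 \<le> u" "0 \<le> v" "u + v = 1"
  have "u *\<^sub>R x + v *\<^sub>R y - a = u *\<^sub>R (x - a) + v *\<^sub>R (y - a)"
    using uv by (simp add: algebra_simps flip: scaleR_add_left)
  then have "infdist (u *\<^sub>R x + v *\<^sub>R y - a) V \<le> u * infdist (x - a) V + v * infdist (y - a) V"
    using infdist_add_le[of "u *\<^sub>R (x - a)" "v *\<^sub>R (y - a)"] infdist_scaleR_subspace uv by simp
  also have "\<dots> \<le> u * d + v * d" using xy uv by (intro add_mono mult_left_mono) auto
  finally show "u *\<^sub>R x + v *\<^sub>R y \<in> {z. infdist (z - a) V \<le> d}"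
    using uv by (simp flip: distrib_right)
qed

lemma finite_codim_basis:
  assumes "finite_codim V"
  shows "\<exists>(n::nat) (e :: nat \<Rightarrow> 'a). (\<forall>x. \<exists>t. x - (\<Sum>i<n. t i *\<^sub>R e i) \<in> V) \<and>
    (\<forall>t i. (\<Sum>i<n. t i *\<^sub>R e i) \<in> V \<longrightarrow> i < n \<longrightarrow> t i = 0)"
proof -
  define P where "P n \<longleftrightarrow> (\<exists>e :: nat \<Rightarrow> 'a. span (V \<union> e ` {..<n}) = UNIV)" for n
  obtain B where B: "finite B" "span (V \<union> B) = UNIV" using assms by (auto simp: finite_codim_def)
  have "\<exists>n. P n"
  proof -
    obtain e :: "nat \<Rightarrow> 'a" where "bij_betw e {0..<card B} B" using ex_bij_betw_nat_finite[OF B(1)] by blast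
    then have "e ` {..<card B} = B" by (simp add: bij_betw_def atLeast0LessThan)
    then show ?thesis using B unfolding P_def by metis
  qed
  then have least: "P (LEAST n. P n)" by (rule LeastI_ex)
  define n where "n = (LEAST n. P n)"
  obtain e where e: "span (V \<union> e ` {..<n}) = UNIV" using least unfolding P_def n_def by blast
  have "\<exists>t. x - (\<Sum>i<n. t i *\<^sub>R e i) \<in> V" for x
  proof -
    let ?S = "{x. \<exists>t. x - (\<Sum>i<n. t i *\<^sub>R e i) \<in> V}"
    have "subspace ?S"
    proof (rule subspaceI)
      show "0 \<in> ?S" using subspace_0[OF V] by (auto intro!: exI[of _ "\<lambda>_. 0"])
    next
      fix x y assume "x \<in> ?S" "y \<in> ?S"
      then obtain s t where "x - (\<Sum>i<n. s i *\<^sub>R e i) \<in> V" "y - (\<Sum>i<n. t i *\<^sub>R e i) \<in> V" by blast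
      then have "(x - (\<Sum>i<n. s i *\<^sub>R e i)) + (y - (\<Sum>i<n. t i *\<^sub>R e i)) \<in> V" by (rule subspace_add[OF V])
      then have "x + y - (\<Sum>i<n. (s i + t i) *\<^sub>R e i) \<in> V"
        by (simp add: scaleR_add_left sum.distrib algebra_simps)
      then show "x + y \<in> ?S" by (auto intro!: exI[of _ "\<lambda>i. s i + t i"])
    next
      fix c x assume "x \<in> ?S"
      then obtain s where "x - (\<Sum>i<n. s i *\<^sub>R e i) \<in> V" by blast
      then have "c *\<^sub>R (x - (\<Sum>i<n. s i *\<^sub>R e i)) \<in> V" by (rule subspace_scale[OF V])
      then have "c *\<^sub>R x - (\<Sum>i<n. (c * s i) *\<^sub>R e i) \<in> V"
        by (simp add: scaleR_diff_right scaleR_sum_right)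
      then show "c *\<^sub>R x \<in> ?S" by (auto intro!: exI[of _ "\<lambda>i. c * s i"])
    qed
    moreover have "V \<union> e ` {..<n} \<subseteq> ?S"
    proof
      fix x assume "x \<in> V \<union> e ` {..<n}"
      then consider "x \<in> V" | j where "j < n" "x = e j" by blast
      then show "x \<in> ?S"
      proof cases
        case 1 then show ?thesis by (auto intro!: exI[of _ "\<lambda>_. 0"])
      next
        case 2
        have "(\<Sum>i<n. (if i = j then 1 else 0) *\<^sub>R e i) = (\<Sum>i<n. if i = j then e i else 0)"
          by (intro sum.cong) auto
        then have "(\<Sum>i<n. (if i = j then 1 else 0) *\<^sub>R e i) = e j" using 2 by simp
        then show ?thesis using 2 subspace_0[OF V] by (auto intro!: exI[of _ "\<lambda>i. if i = j then 1 else 0"])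
      qed
    qed
    ultimately have "span (V \<union> e ` {..<n}) \<subseteq> ?S" by (intro span_minimal)
    then show ?thesis using e by auto
  qed
  moreover have "t j = 0" if tV: "(\<Sum>i<n. t i *\<^sub>R e i) \<in> V" and j: "j < n" for t j
  proof (rule ccontr)
    assume tj: "t j \<noteq> 0"
    \<comment> \<open>The last vector moves into the freed slot \<open>j\<close>, so that the
      remaining ones are again indexed by an initial segment; for \<open>j = n - 1\<close> nothing
      moves.\<close>
    define e' where "e' = e(j := e (n - 1))"
    let ?S = "span (V \<union> e' ` {..<n - 1})"
    have other: "e i \<in> ?S" if "i < n" "i \<noteq> j" for i
    proof (cases "i = n - 1")
      case True
      then have "e' j = e i" "j < n - 1" using that j by (auto simp: e'_def)
      then show ?thesis by (metis UnI2 imageI lessThan_iff span_base)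
    next
      case False
      then have "e' i = e i" "i < n - 1" using that by (auto simp: e'_def)
      then show ?thesis by (metis UnI2 imageI lessThan_iff span_base)
    qed
    have "(\<Sum>i<n. t i *\<^sub>R e i) = t j *\<^sub>R e j + (\<Sum>i\<in>{..<n} - {j}. t i *\<^sub>R e i)"
      using j by (intro sum.remove) auto
    moreover have "(\<Sum>i\<in>{..<n} - {j}. t i *\<^sub>R e i) \<in> ?S"
      by (intro span_sum span_scale other) auto
    moreover have "(\<Sum>i<n. t i *\<^sub>R e i) \<in> ?S" using tV by (simp add: span_base)
    ultimately have "t j *\<^sub>R e j \<in> ?S" by (simp add: span_add_eq2)
    then have "e j \<in> ?S" using tj span_scale[of "t j *\<^sub>R e j" _ "inverse (t j)"] by simp
    then have "V \<union> e ` {..<n} \<subseteq> ?S" using other span_base by blast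
    then have "span (V \<union> e ` {..<n}) \<subseteq> ?S" by (rule span_minimal) simp
    then have "P (n - 1)" using e unfolding P_def by (metis top.extremum_uniqueI)
    then show False using j not_less_Least[of "n - 1" P] unfolding n_def by fastforce
  qed
  ultimately show ?thesis by blast
qed

text \<open>Norms on the finite-dimensional quotient are equivalent: \<kappa> is the minimum of the
  quotient norm over the compact sphere of coordinate vectors of maximum norm 1, positive because
  \<open>V\<close> is closed and the \<open>e i\<close> are independent modulo \<open>V\<close>. For
  \<open>n = 0\<close> the sphere is empty and \<kappa> is arbitrary.\<close>

lemma finite_codim_coordinates:
  assumes "finite_codim V" "closed V"
  shows "\<exists>(n::nat) (e :: nat \<Rightarrow> 'a) c \<kappa>. 0 < \<kappa> \<and>
    (\<forall>x. x - (\<Sum>i<n. c x i *\<^sub>R e i) \<in> V) \<and> (\<forall>x i. n \<le> i \<longrightarrow> c x i = 0) \<and>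
    (\<forall>t i. i < n \<longrightarrow> \<kappa> * \<bar>t i\<bar> \<le> infdist (\<Sum>i<n. t i *\<^sub>R e i) V)"
proof -
  obtain e :: "nat \<Rightarrow> 'a" and n :: nat where ex: "\<And>x. \<exists>t. x - (\<Sum>i<n. t i *\<^sub>R e i) \<in> V"
    and ind: "\<And>t i. (\<Sum>i<n. t i *\<^sub>R e i) \<in> V \<Longrightarrow> i < n \<Longrightarrow> t i = 0"
    using finite_codim_basis[OF assms(1)] by blast
  let ?T = "\<lambda>t. \<Sum>i<n. t i *\<^sub>R e i"
  have "\<exists>t. x - ?T t \<in> V \<and> (\<forall>i\<ge>n. t i = 0)" for x
  proof -
    obtain t where "x - ?T t \<in> V" using ex by blast
    then show ?thesis by (intro exI[of _ "\<lambda>i. if i < n then t i else 0"]) auto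
  qed
  then obtain c where c: "\<And>x. x - ?T (c x) \<in> V" "\<And>x i. n \<le> i \<Longrightarrow> c x i = 0" by metis
  define S where "S = {t::nat \<Rightarrow> real. \<forall>i. t i \<in> (if i < n then {-1..1} else {0})} \<inter> (\<Union>j<n. {t. \<bar>t j\<bar> = 1})"
  have co: "continuous_on UNIV (\<lambda>t::nat \<Rightarrow> real. t i)" for i by (rule continuous_on_product_coordinates)
  have "compact S" unfolding S_def
  proof (rule compact_Int_closed)
    show "compact {t::nat \<Rightarrow> real. \<forall>i. t i \<in> (if i < n then {-1..1} else {0})}"
      by (rule compact_pointwise) auto
    show "closed (\<Union>j<n. {t::nat \<Rightarrow> real. \<bar>t j\<bar> = 1})"
      by (intro closed_UN ballI closed_Collect_eq continuous_on_rabs continuous_on_const co) auto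
  qed
  have cT: "continuous_on A (\<lambda>t. infdist (?T t) V)" for A
    by (intro continuous_on_infdist continuous_intros continuous_on_subset[OF co]) auto
  have "\<exists>\<kappa>>0. \<forall>t\<in>S. \<kappa> \<le> infdist (?T t) V"
  proof (cases "S = {}")
    case False
    obtain t0 where t0: "t0 \<in> S" "\<forall>t\<in>S. infdist (?T t0) V \<le> infdist (?T t) V"
      using continuous_attains_inf[OF \<open>compact S\<close> False cT] by blast
    have "?T t0 \<notin> V"
    proof
      assume "?T t0 \<in> V"
      then have "t0 i = 0" if "i < n" for i using ind that by blast
      then show False using t0 by (auto simp: S_def)
    qed
    then have "0 < infdist (?T t0) V"
      using in_closed_iff_infdist_zero[OF assms(2)] subspace_0[OF V] infdist_nonneg by (metis empty_iff less_le)
    then show ?thesis using t0 by blast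
  qed (auto intro: exI[of _ 1])
  then obtain \<kappa> where \<kappa>: "0 < \<kappa>" "\<And>t. t \<in> S \<Longrightarrow> \<kappa> \<le> infdist (?T t) V" by blast
  have "\<kappa> * \<bar>t i\<bar> \<le> infdist (?T t) V" if i: "i < n" for t i
  proof -
    obtain j where j: "j < n" "\<And>i. i < n \<Longrightarrow> \<bar>t i\<bar> \<le> \<bar>t j\<bar>"
    proof -
      have "Max ((\<lambda>i. \<bar>t i\<bar>) ` {..<n}) \<in> (\<lambda>i. \<bar>t i\<bar>) ` {..<n}" using i by (intro Max_in) auto
      then obtain j where "j < n" "\<bar>t j\<bar> = Max ((\<lambda>i. \<bar>t i\<bar>) ` {..<n})" by auto
      then show ?thesis using that[of j] by simp
    qed
    show ?thesis
    proof (cases "t j = 0")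
      case True
      then show ?thesis using j(2)[OF i] infdist_nonneg by simp
    next
      case False
      define s where "s i = (if i < n then t i / \<bar>t j\<bar> else 0)" for i
      have "\<bar>s i\<bar> \<le> 1" if "i < n" for i using j(2)[OF that] False by (simp add: s_def)
      then have "-1 \<le> s i \<and> s i \<le> 1" if "i < n" for i using that abs_le_D1 abs_le_D2 by fastforce
      moreover have "\<bar>s j\<bar> = 1" using j(1) False by (simp add: s_def)
      ultimately have "s \<in> S" unfolding S_def using j(1) by (auto simp: s_def)
      then have "\<kappa> \<le> infdist (?T s) V" by (rule \<kappa>(2))
      also have "?T s = (1 / \<bar>t j\<bar>) *\<^sub>R ?T t" unfolding scaleR_sum_right by (intro sum.cong) (auto simp: s_def)
      finally have "\<kappa> * \<bar>t j\<bar> \<le> infdist (?T t) V"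
        using False by (simp add: infdist_scaleR_subspace field_simps)
      moreover have "\<kappa> * \<bar>t i\<bar> \<le> \<kappa> * \<bar>t j\<bar>" using j(2)[OF i] \<kappa>(1) by simp
      ultimately show ?thesis by linarith
    qed
  qed
  then show ?thesis using \<kappa>(1) c
    by (intro exI[of _ n] exI[of _ e] exI[of _ c] exI[of _ \<kappa>]) auto
qed

end

text \<open>Brouwer's theorem in the finite-dimensional quotient by \<open>V\<close>, whose ball of radius \<open>r\<close> is
  parametrised by the compact set \<open>Q\<close> of coordinate vectors.\<close>

lemma quotient_ball_brouwer:
  fixes V :: "'a::real_normed_vector set"
  assumes "V \<in> cof" and r: "0 < r"
  shows "\<exists>(Q :: (nat \<Rightarrow> real) set) (T :: (nat \<Rightarrow> real) \<Rightarrow> 'a).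
    compact Q \<and> continuous_on Q T \<and> (\<forall>t\<in>Q. infdist (T t) V \<le> r) \<and>
    (\<forall>\<psi>. continuous_on Q \<psi> \<longrightarrow> (\<forall>t\<in>Q. infdist (T t - \<psi> t) V \<le> r) \<longrightarrow> (\<exists>t\<in>Q. \<psi> t \<in> V))"
proof -
  have V: "subspace V" and cl: "closed V" and fc: "finite_codim V" using assms by (auto simp: cof_def)
  obtain n :: nat and e :: "nat \<Rightarrow> 'a" and c \<kappa> where \<kappa>: "0 < \<kappa>"
    and c: "\<And>x. x - (\<Sum>i<n. c x i *\<^sub>R e i) \<in> V" and c0: "\<And>x i. n \<le> i \<Longrightarrow> c x i = 0"
    and low: "\<And>t i. i < n \<Longrightarrow> \<kappa> * \<bar>t i\<bar> \<le> infdist (\<Sum>i<n. t i *\<^sub>R e i) V"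
    using finite_codim_coordinates[OF V fc cl] by blast
  define T where "T t = (\<Sum>i<n. t i *\<^sub>R e i)" for t :: "nat \<Rightarrow> real"
  define M where "M = r / \<kappa>"
  have M: "0 < M" using r \<kappa> by (simp add: M_def)
  define B where "B = {t :: nat \<Rightarrow> real. \<forall>i. t i \<in> (if i < n then {-M..M} else {0})}"
  define Q where "Q = B \<inter> {t. infdist (T t) V \<le> r}"
  have co: "continuous_on A (\<lambda>t::nat \<Rightarrow> real. t i)" for A i
    by (rule continuous_on_subset[OF continuous_on_product_coordinates]) simp
  have T: "continuous_on A T" for A unfolding T_def by (intro continuous_intros co)
  have cinf: "continuous_on A (\<lambda>t. infdist (T t) V)" for A by (intro continuous_on_infdist T)
  have "compact B" unfolding B_def by (rule compact_pointwise) auto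
  then have Q: "compact Q" unfolding Q_def
    by (rule compact_Int_closed) (intro closed_Collect_le cinf continuous_intros)
  have scale: "T (\<lambda>i. a * t i) = a *\<^sub>R T t" for a t by (simp add: T_def scaleR_sum_right)
  have inQ: "t \<in> Q" if "infdist (T t) V \<le> r" "\<And>i. n \<le> i \<Longrightarrow> t i = 0" for t
  proof -
    have "\<bar>t i\<bar> \<le> M" if "i < n" for i
      using low[OF that, of t] \<open>infdist (T t) V \<le> r\<close> \<kappa> unfolding T_def M_def
      by (simp add: field_simps)
    then show ?thesis using that by (auto simp: Q_def B_def abs_le_iff minus_le_iff)
  qed
  have infT: "infdist (T (c x)) V = infdist x V" for x
    using infdist_diff_subspace[OF V c[of x], of x] by (simp add: T_def)
  have clip: "\<bar>c x i - c y i\<bar> \<le> norm (x - y) / \<kappa>" for x y i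
  proof (cases "i < n")
    case True
    have eq: "T (\<lambda>i. c x i - c y i) + ((x - T (c x)) - (y - T (c y))) = x - y"
      by (simp add: T_def scaleR_diff_left sum_subtractf)
    have "(x - T (c x)) - (y - T (c y)) \<in> V" unfolding T_def by (rule subspace_diff[OF V c c])
    from infdist_add_subspace[OF V this, of "T (\<lambda>i. c x i - c y i)", unfolded eq]
    have "infdist (T (\<lambda>i. c x i - c y i)) V = infdist (x - y) V" ..
    then show ?thesis using low[OF True, of "\<lambda>i. c x i - c y i"] infdist_le_norm_subspace[OF V, of "x - y"] \<kappa>
      by (simp add: T_def field_simps)
  qed (use c0 \<kappa> in auto)
  have cc: "continuous_on A (\<lambda>x. c x i)" for A i
  proof (rule continuous_onI)
    fix x and d :: real assume "0 < d"
    moreover have "dist (c x' i) (c x i) \<le> d" if "dist x' x < d * \<kappa>" for x'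
    proof -
      have "norm (x' - x) / \<kappa> < d" using that \<kappa> by (simp add: dist_norm divide_less_eq)
      then show ?thesis using clip[of x' i x] by (simp add: dist_norm)
    qed
    ultimately show "\<exists>d'>0. \<forall>x'\<in>A. dist x' x < d' \<longrightarrow> dist (c x' i) (c x i) \<le> d"
      using \<kappa> by (intro exI[of _ "d * \<kappa>"]) auto
  qed
  have "\<exists>t\<in>Q. \<psi> t \<in> V"
    if \<psi>: "continuous_on Q \<psi>" and \<psi>r: "\<And>t. t \<in> Q \<Longrightarrow> infdist (T t - \<psi> t) V \<le> r" for \<psi>
  proof -
    define C where "C = {u :: nat \<Rightarrow> real. \<forall>i. u i \<in> (if i < n then {0..1} else {0})}"
    define tt where "tt u i = (if i < n then (2 * u i - 1) * M else 0)" for u :: "nat \<Rightarrow> real" and i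
    \<comment> \<open>The radial retraction onto the quotient ball: \<psi> is controlled only on
      \<open>Q\<close>, while the self-map to which Brouwer's theorem is applied lives on a whole
      box.\<close>
    define ret where "ret t i = (1 / max 1 (infdist (T t) V / r)) * t i" for t :: "nat \<Rightarrow> real" and i :: nat
    define G where "G t = T (ret t) - \<psi> (ret t)" for t
    define F where "F u i = (if i < n then (c (G (tt u)) i / M + 1) / 2 else 0)" for u i
    have retQ: "ret (tt u) \<in> Q" for u
    proof (rule inQ)
      let ?m = "max 1 (infdist (T (tt u)) V / r)"
      have "T (ret (tt u)) = (1 / ?m) *\<^sub>R T (tt u)" unfolding ret_def by (rule scale)
      then have "infdist (T (ret (tt u))) V = infdist (T (tt u)) V / ?m"
        by (simp add: infdist_scaleR_subspace[OF V])
      also have "\<dots> \<le> r" using r by (simp add: divide_le_eq max_def field_simps)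
      finally show "infdist (T (ret (tt u))) V \<le> r" .
      show "ret (tt u) i = 0" if "n \<le> i" for i using that by (simp add: ret_def tt_def)
    qed
    have Gr: "infdist (G (tt u)) V \<le> r" for u unfolding G_def using \<psi>r retQ by blast
    have ctt: "continuous_on C tt"
    proof (rule continuous_on_coordinatewise_then_product)
      show "continuous_on C (\<lambda>u. tt u i)" for i
        unfolding tt_def by (cases "i < n") (auto intro!: continuous_intros co)
    qed
    have "continuous_on UNIV ret"
      by (intro continuous_on_coordinatewise_then_product) (use r in \<open>auto simp: ret_def intro!: continuous_intros co cinf\<close>)
    then have crt: "continuous_on C (\<lambda>u. ret (tt u))"
      by (rule continuous_on_compose2[OF _ ctt]) auto
    have cG: "continuous_on C (\<lambda>u. G (tt u))" unfolding G_def
      by (intro continuous_on_diff continuous_on_compose2[OF T[of UNIV] crt] continuous_on_compose2[OF \<psi> crt])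
         (use retQ in auto)
    have "continuous_on C (\<lambda>u. F u i)" for i
      unfolding F_def using M
      by (cases "i < n") (auto intro!: continuous_intros continuous_on_compose2[OF cc[of UNIV] cG])
    then have cF: "continuous_on C F" by (rule continuous_on_coordinatewise_then_product)
    have cb: "\<bar>c (G (tt u)) i\<bar> \<le> M" if "i < n" for u i
      using low[OF that, of "c (G (tt u))"] infT[of "G (tt u)"] Gr[of u] \<kappa>
      by (simp add: M_def T_def field_simps)
    have FC: "F u \<in> C" for u
    proof -
      have "-1 \<le> c (G (tt u)) i / M \<and> c (G (tt u)) i / M \<le> 1" if "i < n" for i
        using cb[OF that, of u] M by (simp add: field_simps abs_le_iff)
      then show ?thesis by (auto simp: C_def F_def) (smt (verit))
    qed
    obtain u where u: "u \<in> C" "F u = u"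
      using brouwer_nat_cube[of n F, folded C_def, OF cF FC] by blast
    define t where "t = tt u"
    \<comment> \<open>At a fixed point \<open>T t\<close> and \<open>G t\<close> agree modulo
      \<open>V\<close>. Hence \<open>t\<close> lies in the quotient ball, the retraction fixes it,
      \<open>G t\<close> is \<open>T t - \<psi> t\<close>, and so
      \<open>\<psi> t \<in> V\<close>.\<close>
    have teq: "t = c (G t)"
    proof
      fix i
      have "u i = (c (G t) i / M + 1) / 2" if "i < n"
        using fun_cong[OF u(2), of i] that by (simp add: F_def t_def)
      then show "t i = c (G t) i" using M c0[of i "G t"] by (simp add: t_def tt_def field_simps)
    qed
    have "infdist (T t) V = infdist (G t) V" using infT[of "G t"] teq by simp
    also have "\<dots> \<le> r" using Gr t_def by blast
    finally have tr: "infdist (T t) V \<le> r" .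
    then have "ret t = t" using r by (auto simp: ret_def max_def fun_eq_iff)
    moreover have "t \<in> Q" using tr by (rule inQ) (simp add: t_def tt_def)
    moreover have "G t - T t \<in> V" using c[of "G t"] teq by (simp add: T_def)
    ultimately have "- (\<psi> t) \<in> V" by (simp add: G_def)
    then show ?thesis using \<open>t \<in> Q\<close> subspace_neg[OF V] by fastforce
  qed
  moreover have "\<forall>t\<in>Q. infdist (T t) V \<le> r" by (simp add: Q_def)
  ultimately show ?thesis using Q T by (intro exI[of _ Q] exI[of _ T]) simp
qed

text \<open>A displacement bounded by the radius cannot push the ball of the quotient by
  \<open>V\<close> off the origin. The map \<phi> may be discontinuous: it is evaluated only on the
  finite set \<open>F\<close>, and a continuous average of its values inherits the displacement
  bound and costs \<omega> at the end. \<open>F\<close> depends on \<open>V\<close> and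
  \<open>r\<close> alone.\<close>

lemma gorelik_principle:
  fixes V :: "'a::real_normed_vector set"
  assumes V: "V \<in> cof" and r: "0 < r"
  obtains F where "finite F" "F \<subseteq> cball 0 (2 * r)"
    "\<And>\<phi> \<omega>. (\<And>a. a \<in> F \<Longrightarrow> norm (\<phi> a - a) \<le> r / 2) \<Longrightarrow>
        (\<And>a b. a \<in> F \<Longrightarrow> b \<in> F \<Longrightarrow> norm (a - b) \<le> 2 \<Longrightarrow> norm (\<phi> a - \<phi> b) \<le> \<omega>) \<Longrightarrow>
        \<exists>a\<in>F. \<exists>z\<in>V. norm (z - \<phi> a) \<le> \<omega>"
proof -
  have sV: "subspace V" using V by (simp add: cof_def)
  obtain Q :: "(nat \<Rightarrow> real) set" and T :: "(nat \<Rightarrow> real) \<Rightarrow> 'a"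
    where QT: "compact Q \<and> continuous_on Q T \<and> (\<forall>t\<in>Q. infdist (T t) V \<le> r) \<and>
      (\<forall>\<psi>. continuous_on Q \<psi> \<longrightarrow> (\<forall>t\<in>Q. infdist (T t - \<psi> t) V \<le> r) \<longrightarrow> (\<exists>t\<in>Q. \<psi> t \<in> V))"
    using quotient_ball_brouwer[OF V r] by (elim exE) (rule that)
  then have Q: "compact Q" and cT: "continuous_on Q T" and Tr: "\<And>t. t \<in> Q \<Longrightarrow> infdist (T t) V \<le> r"
    and brouwer: "\<And>\<psi>. continuous_on Q \<psi> \<Longrightarrow> (\<And>t. t \<in> Q \<Longrightarrow> infdist (T t - \<psi> t) V \<le> r) \<Longrightarrow> \<exists>t\<in>Q. \<psi> t \<in> V"
    by blast+
  \<comment> \<open>A continuous \<open>s\<close> that lifts the quotient ball up to an error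
    \<open>r / 4\<close>: representatives \<open>T t - v t\<close> of norm below
    \<open>5 * r / 4\<close> are averaged by bumps of width \<open>r / 4\<close> in the quotient
    seminorm.\<close>
  obtain T1 where T1: "T1 \<subseteq> Q" and pou1: "\<And>h :: (nat \<Rightarrow> real) \<Rightarrow> 'a. \<exists>s. continuous_on Q s \<and>
      (\<forall>x\<in>Q. s x \<in> convex hull (h ` {t \<in> T1. 0 < max 0 (r / 4 - infdist (T x - T t) V)}))"
    by (rule compact_partition_of_unity[OF Q, of "\<lambda>t x. max 0 (r / 4 - infdist (T x - T t) V)"])
       (use r subspace_0[OF sV] in \<open>auto intro!: continuous_intros cT continuous_on_infdist simp: infdist_zero\<close>)
  have "\<exists>v. v \<in> V \<and> norm (T t - v) < 5 * r / 4" if "t \<in> Q" for t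
    using infdist_less_subspace[OF sV, of "T t" "5 * r / 4"] Tr[OF that] r by force
  then obtain v where v: "\<And>t. t \<in> Q \<Longrightarrow> v t \<in> V" "\<And>t. t \<in> Q \<Longrightarrow> norm (T t - v t) < 5 * r / 4" by metis
  obtain s where s: "continuous_on Q s" and shull: "\<And>x. x \<in> Q \<Longrightarrow> s x \<in> convex hull
      ((\<lambda>t. T t - v t) ` {t \<in> T1. 0 < max 0 (r / 4 - infdist (T x - T t) V)})"
    using pou1[of "\<lambda>t. T t - v t"] by blast
  have snorm: "norm (s x) \<le> 2 * r" if x: "x \<in> Q" for x
  proof -
    have "norm (T t - v t) \<le> 2 * r" if "t \<in> T1" for t using v(2)[of t] subsetD[OF T1 that] r by simp
    then have "convex hull ((\<lambda>t. T t - v t) ` {t \<in> T1. 0 < max 0 (r / 4 - infdist (T x - T t) V)}) \<subseteq> cball 0 (2 * r)"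
      by (intro hull_minimal convex_cball image_subsetI) simp
    then show ?thesis using shull[OF x] by auto
  qed
  have sT: "infdist (T x - s x) V \<le> r / 4" if x: "x \<in> Q" for x
  proof -
    have "infdist (T t - v t - T x) V \<le> r / 4" if "t \<in> T1" "0 < max 0 (r / 4 - infdist (T x - T t) V)" for t
    proof -
      have "infdist (T t - v t - T x) V = infdist (T t - T x) V"
        using infdist_diff_subspace[OF sV v(1), of t "T t - T x"] that T1 by (auto simp: algebra_simps)
      also have "\<dots> = infdist (T x - T t) V" using infdist_subspace_minus[OF sV, of "T x - T t"] by simp
      finally show ?thesis using that by (simp add: max_def split: if_splits)
    qed
    then have "convex hull ((\<lambda>t. T t - v t) ` {t \<in> T1. 0 < max 0 (r / 4 - infdist (T x - T t) V)})
        \<subseteq> {z. infdist (z - T x) V \<le> r / 4}"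
      by (intro hull_minimal convex_infdist_subspace[OF sV]) auto
    then have "infdist (s x - T x) V \<le> r / 4" using shull[OF x] by auto
    then show ?thesis using infdist_subspace_minus[OF sV, of "s x - T x"] by simp
  qed
  \<comment> \<open>Points whose bumps are active together are within
    \<open>2 * \<delta> \<le> 2\<close>, hence the scale 2 in the oscillation. With
    \<open>\<delta> \<le> r / 4\<close> the errors of \<open>s\<close>, of the bumps and of \<phi>
    add up to \<open>r / 4 + r / 4 + r / 2 = r\<close>.\<close>
  define \<delta> where "\<delta> = min 1 (r / 4)"
  have \<delta>: "0 < \<delta>" "\<delta> \<le> 1" "\<delta> \<le> r / 4" using r by (auto simp: \<delta>_def)
  obtain T2 where T2: "finite T2" "T2 \<subseteq> Q" and pou: "\<And>h :: (nat \<Rightarrow> real) \<Rightarrow> 'a. \<exists>\<psi>. continuous_on Q \<psi> \<and>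
      (\<forall>x\<in>Q. \<psi> x \<in> convex hull (h ` {t \<in> T2. 0 < max 0 (\<delta> - norm (s x - s t))}))"
    by (rule compact_partition_of_unity[OF Q, of "\<lambda>t x. max 0 (\<delta> - norm (s x - s t))"])
       (use \<delta> in \<open>auto intro!: continuous_intros s\<close>)
  show ?thesis
  proof (rule that[of "s ` T2"])
    show "finite (s ` T2)" using T2 by simp
    show "s ` T2 \<subseteq> cball 0 (2 * r)" using snorm T2 by auto
    fix \<phi> :: "'a \<Rightarrow> 'a" and \<omega>
    assume near: "\<And>a. a \<in> s ` T2 \<Longrightarrow> norm (\<phi> a - a) \<le> r / 2"
      and osc: "\<And>a b. a \<in> s ` T2 \<Longrightarrow> b \<in> s ` T2 \<Longrightarrow> norm (a - b) \<le> 2 \<Longrightarrow> norm (\<phi> a - \<phi> b) \<le> \<omega>"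
    obtain \<psi> where \<psi>: "continuous_on Q \<psi>"
      and \<psi>hull: "\<And>x. x \<in> Q \<Longrightarrow> \<psi> x \<in> convex hull ((\<lambda>t. \<phi> (s t)) ` {t \<in> T2. 0 < max 0 (\<delta> - norm (s x - s t))})"
      using pou[of "\<lambda>t. \<phi> (s t)"] by blast
    have "infdist (T x - \<psi> x) V \<le> r" if x: "x \<in> Q" for x
    proof -
      have "norm (s x - \<phi> (s t)) \<le> 3 * r / 4" if "t \<in> T2" "0 < max 0 (\<delta> - norm (s x - s t))" for t
      proof -
        have "norm (s x - \<phi> (s t)) \<le> norm (s x - s t) + norm (s t - \<phi> (s t))"
          using norm_triangle_ineq[of "s x - s t" "s t - \<phi> (s t)"] by simp
        also have "norm (s t - \<phi> (s t)) \<le> r / 2" using near[of "s t"] that by (auto simp: norm_minus_commute)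
        finally show ?thesis using that \<delta> by (simp add: max_def split: if_splits)
      qed
      then have "convex hull ((\<lambda>t. \<phi> (s t)) ` {t \<in> T2. 0 < max 0 (\<delta> - norm (s x - s t))}) \<subseteq> cball (s x) (3 * r / 4)"
        by (intro hull_minimal convex_cball) (auto simp: dist_norm)
      then have "norm (s x - \<psi> x) \<le> 3 * r / 4" using \<psi>hull[OF x] by (auto simp: dist_norm)
      then have "infdist (s x - \<psi> x) V \<le> 3 * r / 4" using infdist_le_norm_subspace[OF sV, of "s x - \<psi> x"] by linarith
      then show ?thesis using infdist_add_le[OF sV, of "T x - s x" "s x - \<psi> x"] sT[OF x] by simp
    qed
    then obtain x where x: "x \<in> Q" "\<psi> x \<in> V" using brouwer[OF \<psi>] by blast
    let ?P = "{t \<in> T2. 0 < max 0 (\<delta> - norm (s x - s t))}"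
    have "?P \<noteq> {}" using \<psi>hull[OF x(1)] by force
    then obtain t0 where t0: "t0 \<in> ?P" by blast
    have "norm (\<phi> (s t0) - \<phi> (s t)) \<le> \<omega>" if "t \<in> ?P" for t
    proof (rule osc)
      have "norm (s t0 - s t) \<le> norm (s x - s t0) + norm (s x - s t)"
        using norm_triangle_ineq4[of "s x - s t" "s x - s t0"] by simp
      then show "norm (s t0 - s t) \<le> 2" using t0 that \<delta> by (simp add: max_def split: if_splits)
    qed (use t0 that in auto)
    then have "convex hull ((\<lambda>t. \<phi> (s t)) ` ?P) \<subseteq> cball (\<phi> (s t0)) \<omega>"
      by (intro hull_minimal convex_cball) (auto simp: dist_norm)
    then have "norm (\<psi> x - \<phi> (s t0)) \<le> \<omega>" using \<psi>hull[OF x(1)] by (auto simp: dist_norm norm_minus_commute)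
    then show "\<exists>a\<in>s ` T2. \<exists>z\<in>V. norm (z - \<phi> a) \<le> \<omega>" using x t0 by blast
  qed
qed

section \<open>Moduli, polars and asymptotically smooth renormings\<close>

lemma equivalent_normD:
  assumes "equivalent_norm N"
  shows "0 \<le> N x" "N x = 0 \<longleftrightarrow> x = 0" "N (c *\<^sub>R x) = \<bar>c\<bar> * N x" "N (x + y) \<le> N x + N y" "N (- x) = N x"
proof -
  show "0 \<le> N x" "N x = 0 \<longleftrightarrow> x = 0" "N (x + y) \<le> N x + N y"
    using assms by (auto simp: equivalent_norm_def is_norm_def)
  show c: "N (c *\<^sub>R x) = \<bar>c\<bar> * N x" for c x
    using assms by (auto simp: equivalent_norm_def is_norm_def)
  show "N (- x) = N x" using c[of "-1" x] by simp
qed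

lemma sphere_perturbation_le:
  assumes "equivalent_norm N" "N x = 1" "N y = 1" "0 \<le> \<tau>"
  shows "N (x + \<tau> *\<^sub>R y) \<le> 1 + \<tau>"
  using equivalent_normD(4)[OF assms(1), of x "\<tau> *\<^sub>R y"] equivalent_normD(3)[OF assms(1), of \<tau> y] assms by simp

lemma UNIV_in_cof: "UNIV \<in> cof"
  by (auto simp: cof_def finite_codim_def intro!: exI[of _ "{}"])

lemma directional_sup_ge_1:
  assumes N: "equivalent_norm N" and Y: "subspace Y" and x: "N x = 1" and ne: "norm_sphere N Y \<noteq> {}" and t: "0 \<le> \<tau>"
  shows "1 \<le> (SUP y\<in>norm_sphere N Y. N (x + \<tau> *\<^sub>R y))"
proof -
  obtain y where y: "y \<in> Y" "N y = 1" using ne by (auto simp: norm_sphere_def)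
  have bdd: "bdd_above ((\<lambda>y. N (x + \<tau> *\<^sub>R y)) ` norm_sphere N Y)"
    using sphere_perturbation_le[OF N x _ t] by (intro bdd_aboveI[of _ "1 + \<tau>"]) (auto simp: norm_sphere_def)
  have "N (x + \<tau> *\<^sub>R y) \<le> (SUP y\<in>norm_sphere N Y. N (x + \<tau> *\<^sub>R y))"
    using y by (intro cSUP_upper[OF _ bdd]) (auto simp: norm_sphere_def)
  moreover have "N (x + \<tau> *\<^sub>R (- y)) \<le> (SUP y\<in>norm_sphere N Y. N (x + \<tau> *\<^sub>R y))"
    using y equivalent_normD(5)[OF N, of y] subspace_neg[OF Y]
    by (intro cSUP_upper[OF _ bdd]) (auto simp: norm_sphere_def)
  moreover have "2 \<le> N (x + \<tau> *\<^sub>R y) + N (x + \<tau> *\<^sub>R (- y))"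
    using equivalent_normD(4)[OF N, of "x + \<tau> *\<^sub>R y" "x + \<tau> *\<^sub>R (- y)"] equivalent_normD(3)[OF N, of 2 x] x
    by (simp add: scaleR_2)
  ultimately show ?thesis by linarith
qed

definition directional_modulus :: "('a::real_normed_vector \<Rightarrow> real) \<Rightarrow> real \<Rightarrow> 'a \<Rightarrow> 'a set \<Rightarrow> real" where
  "directional_modulus N \<tau> x Y =
     (if norm_sphere N Y = {} then 1 else SUP y\<in>norm_sphere N Y. N (x + \<tau> *\<^sub>R y))"

lemma aus_modulus_directional:
  "norm_sphere N UNIV \<noteq> {} \<Longrightarrow>
    aus_modulus N \<tau> = (SUP x\<in>norm_sphere N UNIV. INF Y\<in>cof. directional_modulus N \<tau> x Y) - 1"
  by (simp add: aus_modulus_def directional_modulus_def)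

lemma directional_modulus_bounds:
  assumes N: "equivalent_norm N" and Y: "Y \<in> cof" and x: "N x = 1" and t: "0 \<le> \<tau>"
  shows "1 \<le> directional_modulus N \<tau> x Y" "directional_modulus N \<tau> x Y \<le> 1 + \<tau>"
    "y \<in> Y \<Longrightarrow> N y = 1 \<Longrightarrow> N (x + \<tau> *\<^sub>R y) \<le> directional_modulus N \<tau> x Y"
    "(\<And>y. y \<in> Y \<Longrightarrow> N y = 1 \<Longrightarrow> N (x + \<tau> *\<^sub>R y) \<le> d) \<Longrightarrow> 1 \<le> d \<Longrightarrow> directional_modulus N \<tau> x Y \<le> d"
proof -
  have sY: "subspace Y" using Y by (simp add: cof_def)
  show "1 \<le> directional_modulus N \<tau> x Y"
    using directional_sup_ge_1[OF N sY x _ t] by (simp add: directional_modulus_def)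
  show le: "directional_modulus N \<tau> x Y \<le> d"
    if "\<And>y. y \<in> Y \<Longrightarrow> N y = 1 \<Longrightarrow> N (x + \<tau> *\<^sub>R y) \<le> d" "1 \<le> d" for d
    using that by (auto simp: directional_modulus_def norm_sphere_def intro!: cSUP_least)
  show "directional_modulus N \<tau> x Y \<le> 1 + \<tau>"
    by (rule le) (use sphere_perturbation_le[OF N x _ t] t in auto)
  have bdd: "bdd_above ((\<lambda>y. N (x + \<tau> *\<^sub>R y)) ` norm_sphere N Y)"
    using sphere_perturbation_le[OF N x _ t] by (intro bdd_aboveI[of _ "1 + \<tau>"]) (auto simp: norm_sphere_def)
  show "N (x + \<tau> *\<^sub>R y) \<le> directional_modulus N \<tau> x Y" if "y \<in> Y" "N y = 1"
    using that by (auto simp: directional_modulus_def norm_sphere_def[of N Y] intro!: cSUP_upper bdd[unfolded norm_sphere_def])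
qed

lemma asymptotic_modulus_bounds:
  assumes N: "equivalent_norm N" and x: "N x = 1" and t: "0 \<le> \<tau>"
  shows "1 \<le> (INF Y\<in>cof. directional_modulus N \<tau> x Y)" "(INF Y\<in>cof. directional_modulus N \<tau> x Y) \<le> 1 + \<tau>"
    "Y \<in> cof \<Longrightarrow> (INF Y\<in>cof. directional_modulus N \<tau> x Y) \<le> directional_modulus N \<tau> x Y"
proof -
  have ne: "(cof :: 'a set set) \<noteq> {}" using UNIV_in_cof by blast
  have bdd: "bdd_below (directional_modulus N \<tau> x ` cof)"
    using directional_modulus_bounds(1)[OF N _ x t] by (intro bdd_belowI[of _ 1]) auto
  show "1 \<le> (INF Y\<in>cof. directional_modulus N \<tau> x Y)"
    using directional_modulus_bounds(1)[OF N _ x t] by (intro cINF_greatest[OF ne]) auto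
  show low: "(INF Y\<in>cof. directional_modulus N \<tau> x Y) \<le> directional_modulus N \<tau> x Y" if "Y \<in> cof" for Y
    by (rule cINF_lower[OF bdd that])
  show "(INF Y\<in>cof. directional_modulus N \<tau> x Y) \<le> 1 + \<tau>"
    using low[OF UNIV_in_cof] directional_modulus_bounds(2)[OF N UNIV_in_cof x t] by linarith
qed

text \<open>The modulus is nonnegative by \<open>asymptotic_modulus_bounds\<close>, so an upper
  bound near 0 suffices; halving \<epsilon> makes it strict.\<close>

lemma AUS_I:
  fixes N :: "'a::real_normed_vector \<Rightarrow> real"
  assumes N: "equivalent_norm N"
    and smooth: "\<And>\<epsilon>. 0 < \<epsilon> \<Longrightarrow> \<exists>t0>0. \<forall>\<tau>. 0 < \<tau> \<longrightarrow> \<tau> < t0 \<longrightarrow> (\<forall>x. N x = 1 \<longrightarrow>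
        (\<exists>Y\<in>cof. \<forall>v\<in>Y. N v = 1 \<longrightarrow> N (x + \<tau> *\<^sub>R v) \<le> 1 + \<epsilon> * \<tau>))"
  shows "AUS N"
  unfolding AUS_def
proof (rule tendstoI)
  fix e :: real assume "0 < e"
  then obtain t0 where t0: "0 < t0" and sm: "\<And>\<tau> x. 0 < \<tau> \<Longrightarrow> \<tau> < t0 \<Longrightarrow> N x = 1 \<Longrightarrow>
        \<exists>Y\<in>cof. \<forall>v\<in>Y. N v = 1 \<longrightarrow> N (x + \<tau> *\<^sub>R v) \<le> 1 + e / 2 * \<tau>"
    using smooth[of "e / 2"] by auto
  have "dist (aus_modulus N \<tau> / \<tau>) 0 < e" if \<tau>: "0 < \<tau>" "\<tau> < t0" for \<tau>
  proof (cases "norm_sphere N UNIV = {}")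
    case True
    then show ?thesis using \<open>0 < e\<close> by (simp add: aus_modulus_def)
  next
    case False
    have t: "0 \<le> \<tau>" using \<tau> by simp
    have le: "(INF Y\<in>cof. directional_modulus N \<tau> x Y) \<le> 1 + e / 2 * \<tau>" if "N x = 1" for x
    proof -
      obtain Y where Y: "Y \<in> cof" and v: "\<And>v. v \<in> Y \<Longrightarrow> N v = 1 \<Longrightarrow> N (x + \<tau> *\<^sub>R v) \<le> 1 + e / 2 * \<tau>"
        using sm[OF \<tau> \<open>N x = 1\<close>] by blast
      have "directional_modulus N \<tau> x Y \<le> 1 + e / 2 * \<tau>"
        using directional_modulus_bounds(4)[OF N Y \<open>N x = 1\<close> t v] \<tau> \<open>0 < e\<close> by simp
      then show ?thesis using asymptotic_modulus_bounds(3)[OF N \<open>N x = 1\<close> t Y] by linarith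
    qed
    let ?S = "SUP x\<in>norm_sphere N UNIV. INF Y\<in>cof. directional_modulus N \<tau> x Y"
    have "?S \<le> 1 + e / 2 * \<tau>" using le by (intro cSUP_least[OF False]) (auto simp: norm_sphere_def)
    moreover have "1 \<le> ?S"
    proof -
      obtain x where x: "x \<in> norm_sphere N UNIV" using False by blast
      have "bdd_above ((\<lambda>x. INF Y\<in>cof. directional_modulus N \<tau> x Y) ` norm_sphere N UNIV)"
        using le by (intro bdd_aboveI[of _ "1 + e / 2 * \<tau>"]) (auto simp: norm_sphere_def)
      then have "(INF Y\<in>cof. directional_modulus N \<tau> x Y) \<le> ?S" by (rule cSUP_upper[OF x])
      then show ?thesis using asymptotic_modulus_bounds(1)[OF N _ t, of x] x by (simp add: norm_sphere_def)
    qed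
    ultimately have "0 \<le> aus_modulus N \<tau>" "aus_modulus N \<tau> \<le> e / 2 * \<tau>"
      using aus_modulus_directional[OF False] by auto
    moreover have "e / 2 * \<tau> < e * \<tau>" using \<tau> \<open>0 < e\<close> by simp
    ultimately have "\<bar>aus_modulus N \<tau>\<bar> < e * \<tau>" by linarith
    then show ?thesis using \<tau> by (simp add: dist_real_def divide_less_eq)
  qed
  then show "\<forall>\<^sub>F \<tau> in at_right 0. dist (aus_modulus N \<tau> / \<tau>) 0 < e"
    unfolding eventually_at_right_field using t0 by blast
qed

text \<open>The bound on the modulus at \<tau> is strict, so some subspace already realises it in
  place of the infimum.\<close>

lemma AUS_D:
  fixes N :: "'a::real_normed_vector \<Rightarrow> real"
  assumes N: "equivalent_norm N" and "AUS N" and e: "0 < \<epsilon>" and d: "0 < d"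
  obtains \<tau> where "0 < \<tau>" "\<tau> < d"
    "\<And>x. N x = 1 \<Longrightarrow> \<exists>Y\<in>cof. \<forall>v\<in>Y. N v = 1 \<longrightarrow> N (x + \<tau> *\<^sub>R v) \<le> 1 + \<epsilon> * \<tau>"
proof -
  have "\<forall>\<^sub>F \<tau> in at_right 0. dist (aus_modulus N \<tau> / \<tau>) 0 < \<epsilon>"
    using tendstoD[OF \<open>AUS N\<close>[unfolded AUS_def] e] .
  then obtain b where b: "0 < b" "\<And>\<tau>. 0 < \<tau> \<Longrightarrow> \<tau> < b \<Longrightarrow> dist (aus_modulus N \<tau> / \<tau>) 0 < \<epsilon>"
    unfolding eventually_at_right_field by blast
  define \<tau> where "\<tau> = min b d / 2"
  have \<tau>: "0 < \<tau>" "\<tau> < b" "\<tau> < d" and t: "0 \<le> \<tau>" using b d by (auto simp: \<tau>_def)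
  have "\<bar>aus_modulus N \<tau>\<bar> < \<epsilon> * \<tau>" using b(2)[OF \<tau>(1,2)] \<tau> by (simp add: dist_real_def divide_less_eq)
  then have m: "aus_modulus N \<tau> < \<epsilon> * \<tau>" by linarith
  have "\<exists>Y\<in>cof. \<forall>v\<in>Y. N v = 1 \<longrightarrow> N (x + \<tau> *\<^sub>R v) \<le> 1 + \<epsilon> * \<tau>" if x: "N x = 1" for x
  proof -
    have xs: "x \<in> norm_sphere N UNIV" using x by (simp add: norm_sphere_def)
    have "bdd_above ((\<lambda>x. INF Y\<in>cof. directional_modulus N \<tau> x Y) ` norm_sphere N UNIV)"
      using asymptotic_modulus_bounds(2)[OF N _ t] by (intro bdd_aboveI[of _ "1 + \<tau>"]) (auto simp: norm_sphere_def)
    from cSUP_upper[OF xs this] have "(INF Y\<in>cof. directional_modulus N \<tau> x Y) \<le> aus_modulus N \<tau> + 1"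
      using aus_modulus_directional[of N \<tau>] xs by (metis diff_add_cancel empty_iff)
    then have "(INF Y\<in>cof. directional_modulus N \<tau> x Y) < 1 + \<epsilon> * \<tau>" using m by linarith
    then obtain Y where Y: "Y \<in> cof" "directional_modulus N \<tau> x Y < 1 + \<epsilon> * \<tau>"
      using UNIV_in_cof directional_modulus_bounds(1)[OF N _ x t]
      by (subst (asm) cINF_less_iff) (auto intro!: bdd_belowI[of _ 1])
    have "N (x + \<tau> *\<^sub>R v) \<le> 1 + \<epsilon> * \<tau>" if "v \<in> Y" "N v = 1" for v
      using directional_modulus_bounds(3)[OF N Y(1) x t that] Y(2) by linarith
    then show ?thesis using Y(1) by blast
  qed
  then show ?thesis using that \<tau> by blast
qed

section \<open>Polars and the norms they define\<close>

definition polar :: "'a::real_normed_vector set \<Rightarrow> ('a \<Rightarrow> real) set" where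
  "polar W = {\<phi>. linear \<phi> \<and> (\<forall>w\<in>W. \<phi> w \<le> 1)}"

text \<open>For \<open>W\<close> bounded, symmetric and containing the unit ball, this is the gauge
  of the closed convex hull of \<open>W\<close>, by the bipolar theorem. The dual formula works with
  functionals directly and leaves \<open>W\<close> free to be neither convex nor closed.\<close>

definition polar_norm :: "'a::real_normed_vector set \<Rightarrow> 'a \<Rightarrow> real" where
  "polar_norm W y = (SUP \<phi>\<in>polar W. \<phi> y)"

context
  fixes W :: "'a::real_normed_vector set" and R :: real
  assumes ball: "cball 0 1 \<subseteq> W" and bound: "W \<subseteq> cball 0 R" and sym: "\<forall>w\<in>W. - w \<in> W"
    and R: "0 < R"
begin

lemma polar_le_norm: assumes "\<phi> \<in> polar W" shows "\<bar>\<phi> y\<bar> \<le> norm y"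
proof -
  have lin: "linear \<phi>" and le: "\<And>w. w \<in> W \<Longrightarrow> \<phi> w \<le> 1" using assms by (auto simp: polar_def)
  have "\<phi> y \<le> norm y" for y
  proof (cases "y = 0")
    case False
    have "\<phi> ((1 / norm y) *\<^sub>R y) \<le> 1" using ball by (intro le) (auto simp: False)
    then show ?thesis using False by (simp add: linear_scale[OF lin] field_simps)
  qed (simp add: linear_0[OF lin])
  from this[of y] this[of "- y"] show ?thesis by (simp add: linear_neg[OF lin])
qed

lemma polar_upper: "\<phi> \<in> polar W \<Longrightarrow> \<phi> y \<le> polar_norm W y"
  unfolding polar_norm_def
  by (intro cSUP_upper bdd_aboveI[of _ "norm y"]) (auto intro: abs_le_D1[OF polar_le_norm])

lemma polar_neg: "\<phi> \<in> polar W \<Longrightarrow> (\<lambda>y. - \<phi> y) \<in> polar W"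
proof -
  assume "\<phi> \<in> polar W"
  then have lin: "linear \<phi>" and le: "\<And>w. w \<in> W \<Longrightarrow> \<phi> w \<le> 1" by (auto simp: polar_def)
  have "- \<phi> w \<le> 1" if "w \<in> W" for w using le[OF bspec[OF sym that]] linear_neg[OF lin, of w] by simp
  then show ?thesis using linear_compose_neg[OF lin] by (simp add: polar_def)
qed

lemma zero_polar: "(\<lambda>_. 0) \<in> polar W"
  by (simp add: polar_def linear_zero)

lemma polar_norm_least: "(\<And>\<phi>. \<phi> \<in> polar W \<Longrightarrow> \<phi> y \<le> d) \<Longrightarrow> polar_norm W y \<le> d"
  unfolding polar_norm_def using zero_polar by (intro cSUP_least) auto

lemma less_polar_norm: "d < polar_norm W y \<Longrightarrow> \<exists>\<phi>\<in>polar W. d < \<phi> y"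
  using polar_norm_least[of y d] by (meson not_le)

lemma norm_le_polar_norm: "norm y \<le> R * polar_norm W y"
proof -
  obtain \<phi> where \<phi>: "linear \<phi>" "\<And>x. \<phi> x \<le> norm x" "\<phi> y = norm y" using norming_functional by metis
  have "(1 / R) * \<phi> w \<le> 1" if "w \<in> W" for w
  proof -
    have "\<phi> w \<le> R" using \<phi>(2)[of w] bound that by force
    then show ?thesis using R by (simp add: divide_le_eq)
  qed
  then have "(\<lambda>x. (1 / R) *\<^sub>R \<phi> x) \<in> polar W"
    using linear_compose_scale_right[OF \<phi>(1), of "1 / R"] by (auto simp: polar_def)
  from polar_upper[OF this, of y] show ?thesis using \<phi>(3) R by (simp add: field_simps)
qed

lemma polar_norm_equivalent: "equivalent_norm (polar_norm W)"
proof -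
  have upper: "polar_norm W y \<le> norm y" for y
    by (rule polar_norm_least) (rule abs_le_D1[OF polar_le_norm])
  have lower: "norm y / R \<le> polar_norm W y" for y
    using norm_le_polar_norm[of y] R by (simp add: divide_le_eq mult.commute)
  have nonneg: "0 \<le> polar_norm W y" for y
    using lower[of y] R by (smt (verit) divide_nonneg_nonneg norm_ge_zero)
  have zero: "polar_norm W y = 0 \<longleftrightarrow> y = 0" for y
    using lower[of y] upper[of y] nonneg[of y] R by (auto simp: divide_le_0_iff)
  have sc: "polar_norm W (c *\<^sub>R y) \<le> \<bar>c\<bar> * polar_norm W y" for c y
  proof (rule polar_norm_least)
    fix \<phi> assume \<phi>: "\<phi> \<in> polar W"
    then have lin: "linear \<phi>" by (simp add: polar_def)
    have "\<bar>\<phi> y\<bar> \<le> polar_norm W y"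
      using polar_upper[OF \<phi>, of y] polar_upper[OF polar_neg[OF \<phi>], of y] by linarith
    then have "\<bar>c\<bar> * \<bar>\<phi> y\<bar> \<le> \<bar>c\<bar> * polar_norm W y" by (simp add: mult_left_mono)
    then show "\<phi> (c *\<^sub>R y) \<le> \<bar>c\<bar> * polar_norm W y"
      using linear_scale[OF lin, of c y] by (simp flip: abs_mult)
  qed
  have scale: "polar_norm W (c *\<^sub>R y) = \<bar>c\<bar> * polar_norm W y" for c y
  proof (cases "c = 0")
    case False
    have "polar_norm W y \<le> \<bar>inverse c\<bar> * polar_norm W (c *\<^sub>R y)" using sc[of "inverse c" "c *\<^sub>R y"] False by simp
    then have "\<bar>c\<bar> * polar_norm W y \<le> polar_norm W (c *\<^sub>R y)" using False by (simp add: field_simps abs_inverse)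
    then show ?thesis using sc[of c y] by linarith
  qed (simp add: zero)
  have tri: "polar_norm W (x + y) \<le> polar_norm W x + polar_norm W y" for x y
  proof (rule polar_norm_least)
    fix \<phi> assume \<phi>: "\<phi> \<in> polar W"
    then have "linear \<phi>" by (simp add: polar_def)
    then show "\<phi> (x + y) \<le> polar_norm W x + polar_norm W y"
      using polar_upper[OF \<phi>, of x] polar_upper[OF \<phi>, of y] by (simp add: linear_add)
  qed
  have "is_norm (polar_norm W)" unfolding is_norm_def using nonneg zero scale tri by blast
  moreover have "\<forall>x. (1 / R) * norm x \<le> polar_norm W x \<and> polar_norm W x \<le> 1 * norm x"
    using lower upper by simp
  moreover have "0 < 1 / R" using R by simp
  ultimately show ?thesis unfolding equivalent_norm_def using zero_less_one by blast
qed

end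

text \<open>Banach-Alaoglu: the functionals lie in a product of compact intervals, so the net
  indexed by finite sets has a cluster point. The freedom to demand \<open>J0 \<subseteq> J\<close>
  matters because \<open>J0\<close> will hold \<open>u\<close> itself, which is known only after the
  net.\<close>

lemma functional_cluster_point:
  fixes \<phi> :: "'i set \<Rightarrow> 'b::real_normed_vector \<Rightarrow> real"
  assumes bound: "\<forall>J y. finite J \<longrightarrow> \<bar>\<phi> J y\<bar> \<le> norm y"
  shows "\<exists>u. (\<forall>y. \<bar>u y\<bar> \<le> norm y) \<and>
    (\<forall>T \<delta> J0. finite T \<longrightarrow> 0 < \<delta> \<longrightarrow> finite J0 \<longrightarrow>
        (\<exists>J. finite J \<and> J0 \<subseteq> J \<and> (\<forall>t\<in>T. \<bar>\<phi> J t - u t\<bar> < \<delta>)))"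
proof -
  define K where "K = {\<psi> :: 'b \<Rightarrow> real. \<forall>y. \<psi> y \<in> cball 0 (norm y)}"
  have "compact K" unfolding K_def by (rule compact_pointwise) simp
  define F where "F = filtermap \<phi> (finite_subsets_at_top UNIV)"
  have "F \<noteq> bot" unfolding F_def by (simp add: filtermap_bot_iff)
  have ev: "eventually P F" if "finite J0" "\<And>J. finite J \<Longrightarrow> J0 \<subseteq> J \<Longrightarrow> P (\<phi> J)" for P J0
    unfolding F_def eventually_filtermap eventually_finite_subsets_at_top using that by auto
  have "eventually (\<lambda>\<psi>. \<psi> \<in> K) F"
  proof (rule ev[of "{}"])
    show "\<phi> J \<in> K" if "finite J" for J using bound that by (simp add: K_def)
  qed simp
  then obtain u where u: "u \<in> K" "inf (nhds u) F \<noteq> bot"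
    using \<open>compact K\<close> \<open>F \<noteq> bot\<close> unfolding compact_filter by blast
  show ?thesis
  proof (intro exI[of _ u] conjI allI impI)
    show "\<bar>u y\<bar> \<le> norm y" for y using u(1) by (simp add: K_def)
    fix T :: "'b set" and \<delta> :: real and J0 :: "'i set"
    assume T: "finite T" and \<delta>: "0 < \<delta>" and J0: "finite J0"
    have "open {\<psi>. \<forall>t\<in>T. \<psi> t \<in> ball (u t) \<delta>}" using T by (intro product_topology_basis') auto
    then have "eventually (\<lambda>\<psi>. \<psi> \<in> {\<psi>. \<forall>t\<in>T. \<psi> t \<in> ball (u t) \<delta>}) (nhds u)"
      using \<delta> by (intro eventually_nhds_in_open) auto
    moreover have "eventually (\<lambda>\<psi>. \<exists>J. finite J \<and> J0 \<subseteq> J \<and> \<psi> = \<phi> J) F" by (rule ev[OF J0]) auto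
    ultimately have "eventually (\<lambda>\<psi>. (\<forall>t\<in>T. \<psi> t \<in> ball (u t) \<delta>) \<and> (\<exists>J. finite J \<and> J0 \<subseteq> J \<and> \<psi> = \<phi> J)) (inf (nhds u) F)"
      unfolding eventually_inf by auto
    from eventually_happens'[OF u(2) this]
    show "\<exists>J. finite J \<and> J0 \<subseteq> J \<and> (\<forall>t\<in>T. \<bar>\<phi> J t - u t\<bar> < \<delta>)"
      by (auto simp: dist_real_def abs_minus_commute)
  qed
qed

lemma linear_cluster_point:
  fixes u :: "'b::real_vector \<Rightarrow> real"
  assumes "\<And>T \<delta>. finite T \<Longrightarrow> 0 < \<delta> \<Longrightarrow> \<exists>\<psi>. linear \<psi> \<and> (\<forall>t\<in>T. \<bar>\<psi> t - u t\<bar> < \<delta>)"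
  shows "linear u"
proof (rule linearI)
  fix x y
  have "\<bar>u (x + y) - u x - u y\<bar> \<le> 0"
  proof (rule field_le_epsilon)
    fix e :: real assume "0 < e"
    then obtain \<psi> where lin: "linear \<psi>" and near: "\<forall>t\<in>{x, y, x + y}. \<bar>\<psi> t - u t\<bar> < e / 3"
      using assms[of "{x, y, x + y}" "e / 3"] by auto
    have "\<bar>\<psi> x - u x\<bar> < e / 3" "\<bar>\<psi> y - u y\<bar> < e / 3" "\<bar>\<psi> (x + y) - u (x + y)\<bar> < e / 3"
      using near by auto
    then show "\<bar>u (x + y) - u x - u y\<bar> \<le> 0 + e" using linear_add[OF lin, of x y] by linarith
  qed
  then show "u (x + y) = u x + u y" by simp
next
  fix c x
  have "\<bar>u (c *\<^sub>R x) - c * u x\<bar> \<le> 0"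
  proof (rule field_le_epsilon)
    fix e :: real assume "0 < e"
    define d where "d = e / (1 + \<bar>c\<bar>)"
    have "0 < d" using \<open>0 < e\<close> by (simp add: d_def)
    then obtain \<psi> where lin: "linear \<psi>" and near: "\<forall>t\<in>{x, c *\<^sub>R x}. \<bar>\<psi> t - u t\<bar> < d"
      using assms[of "{x, c *\<^sub>R x}" d] by auto
    have "\<bar>c * (\<psi> x - u x)\<bar> \<le> \<bar>c\<bar> * d" unfolding abs_mult using near by (intro mult_left_mono) auto
    moreover have "\<bar>\<psi> (c *\<^sub>R x) - u (c *\<^sub>R x)\<bar> < d" using near by simp
    moreover have "d + \<bar>c\<bar> * d = e" by (simp add: d_def field_simps add_nonneg_eq_0_iff)
    ultimately show "\<bar>u (c *\<^sub>R x) - c * u x\<bar> \<le> 0 + e"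
      using linear_scale[OF lin, of c x] by (simp add: right_diff_distrib)
  qed
  then show "u (c *\<^sub>R x) = c *\<^sub>R u x" by simp
qed

lemma cof_Int_kernel:
  assumes "Y \<in> cof" "bounded_linear \<psi>"
  shows "Y \<inter> {y. \<psi> y = (0::real)} \<in> cof"
proof -
  interpret bounded_linear \<psi> by fact
  have Y: "subspace Y" "closed Y" using assms by (auto simp: cof_def)
  obtain B where B: "finite B" "span (Y \<union> B) = UNIV" using assms by (auto simp: cof_def finite_codim_def)
  let ?K = "Y \<inter> {y. \<psi> y = 0}"
  have "subspace {y. \<psi> y = 0}" by (rule subspaceI) (auto simp: add scaleR)
  then have "subspace ?K" by (rule subspace_inter[OF Y(1)])
  moreover have "closed ?K"
    by (intro closed_Int Y closed_Collect_eq continuous_intros continuous_on)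
  moreover have "finite_codim ?K"
  proof (cases "\<forall>y\<in>Y. \<psi> y = 0")
    case True
    then have "?K = Y" by auto
    then show ?thesis using assms by (simp add: cof_def)
  next
    case False
    then obtain e where e: "e \<in> Y" "\<psi> e \<noteq> 0" by blast
    let ?S = "span (?K \<union> insert e B)"
    have "Y \<subseteq> ?S"
    proof
      fix y assume y: "y \<in> Y"
      have "y - (\<psi> y / \<psi> e) *\<^sub>R e \<in> ?K"
        using y e subspace_diff[OF Y(1)] subspace_scale[OF Y(1)] by (simp add: diff scaleR)
      then have "y - (\<psi> y / \<psi> e) *\<^sub>R e \<in> ?S" by (simp add: span_base)
      moreover have "(\<psi> y / \<psi> e) *\<^sub>R e \<in> ?S" by (simp add: span_base span_scale)
      ultimately have "(y - (\<psi> y / \<psi> e) *\<^sub>R e) + (\<psi> y / \<psi> e) *\<^sub>R e \<in> ?S" by (rule span_add)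
      then show "y \<in> ?S" by simp
    qed
    moreover have "B \<subseteq> ?S" by (auto intro: span_base)
    ultimately have "span (Y \<union> B) \<subseteq> ?S" by (intro span_minimal) auto
    then have "?S = UNIV" using B by blast
    then show ?thesis using B unfolding finite_codim_def by (intro exI[of _ "insert e B"]) simp
  qed
  ultimately show ?thesis by (simp add: cof_def)
qed

text \<open>The guard \<open>bounded_linear \<psi>\<close> admits arbitrary finite sets of
  functions, so that all finite subsets of one type can index the net.\<close>

lemma common_kernel_cof:
  assumes "finite J"
  shows "{y::'b::real_normed_vector. \<forall>\<psi>\<in>J. bounded_linear \<psi> \<longrightarrow> \<psi> y = (0::real)} \<in> cof"
  using assms
proof (induction J)
  case empty
  then show ?case using UNIV_in_cof by simp
next
  case (insert \<psi> J)
  have "{y. \<forall>\<psi>'\<in>insert \<psi> J. bounded_linear \<psi>' \<longrightarrow> \<psi>' y = 0} =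
    {y. \<forall>\<psi>\<in>J. bounded_linear \<psi> \<longrightarrow> \<psi> y = 0} \<inter> (if bounded_linear \<psi> then {y. \<psi> y = 0} else UNIV)"
    by auto
  then show ?case using insert.IH cof_Int_kernel by (cases "bounded_linear \<psi>") simp_all
qed

text \<open>The polar of a weighted Minkowski sum is the unit ball of the dual norm
  \<open>\<phi> \<mapsto> \<parallel>\<phi>\<parallel> + \<Sum>i. (1/2)^i sup\<^bsub>A i\<^esub> \<phi>\<close>.\<close>

definition weighted_sums :: "(nat \<Rightarrow> 'b::real_normed_vector set) \<Rightarrow> 'b set" where
  "weighted_sums A = {b + (\<Sum>i<k. (1/2)^i *\<^sub>R s i) | b k s. norm b \<le> 1 \<and> (\<forall>i. s i \<in> A i)}"

lemma bounded_linear_dominated: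
  fixes u :: "'b::real_normed_vector \<Rightarrow> real"
  assumes "linear u" "\<And>y. \<bar>u y\<bar> \<le> norm y"
  shows "bounded_linear u"
  using assms by (intro bounded_linear_intro[where K = 1]) (auto simp: linear_add linear_scale)

lemma weighted_sums_props:
  fixes A :: "nat \<Rightarrow> 'b::real_normed_vector set"
  assumes zero: "\<And>i. 0 \<in> A i" and sym: "\<And>i a. a \<in> A i \<Longrightarrow> - a \<in> A i"
    and bound: "\<And>i a. a \<in> A i \<Longrightarrow> norm a \<le> \<Lambda>"
  shows "cball 0 1 \<subseteq> weighted_sums A" "weighted_sums A \<subseteq> cball 0 (1 + 2 * \<Lambda>)"
    "w \<in> weighted_sums A \<Longrightarrow> - w \<in> weighted_sums A" "0 < 1 + 2 * \<Lambda>"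
proof -
  show "cball 0 1 \<subseteq> weighted_sums A"
  proof
    fix b :: 'b assume "b \<in> cball 0 1"
    then show "b \<in> weighted_sums A" unfolding weighted_sums_def using zero
      by (intro CollectI exI[of _ b] exI[of _ 0] exI[of _ "\<lambda>_. 0"]) auto
  qed
  have \<Lambda>: "0 \<le> \<Lambda>" using bound[OF zero[of 0]] by simp
  then show "0 < 1 + 2 * \<Lambda>" by simp
  show "weighted_sums A \<subseteq> cball 0 (1 + 2 * \<Lambda>)"
  proof
    fix w assume "w \<in> weighted_sums A"
    then obtain b k s where w: "w = b + (\<Sum>i<k. (1/2)^i *\<^sub>R s i)" and b: "norm b \<le> 1" and s: "\<And>i. s i \<in> A i"
      by (auto simp: weighted_sums_def)
    have "norm (\<Sum>i<k. (1/2)^i *\<^sub>R s i) \<le> (\<Sum>i<k. (1/2)^i * \<Lambda>)"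
      using bound[OF s] by (intro sum_norm_le) (simp add: mult_left_mono)
    also have "\<dots> = (\<Sum>i<k. (1/2)^i) * \<Lambda>" by (simp add: sum_distrib_right)
    also have "(\<Sum>i<k. (1/2::real)^i) = 2 * (1 - (1/2)^k)" by (simp add: geometric_sum)
    also have "2 * (1 - (1/2)^k) * \<Lambda> \<le> 2 * \<Lambda>" using \<Lambda> by (intro mult_right_mono) auto
    finally have "norm (\<Sum>i<k. (1/2)^i *\<^sub>R s i) \<le> 2 * \<Lambda>" .
    then show "w \<in> cball 0 (1 + 2 * \<Lambda>)"
      using b norm_triangle_ineq[of b "\<Sum>i<k. (1/2)^i *\<^sub>R s i"] w by simp
  qed
  show "- w \<in> weighted_sums A" if neg: "w \<in> weighted_sums A"
  proof -
    obtain b k s where w: "w = b + (\<Sum>i<k. (1/2)^i *\<^sub>R s i)" and b: "norm b \<le> 1" and s: "\<And>i. s i \<in> A i"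
      using neg by (auto simp: weighted_sums_def)
    have "- w = - b + (\<Sum>i<k. (1/2)^i *\<^sub>R (- s i))" using w by (simp add: sum_negf)
    then show ?thesis unfolding weighted_sums_def using b s sym
      by (intro CollectI exI[of _ "- b"] exI[of _ k] exI[of _ "\<lambda>i. - s i"]) auto
  qed
qed

text \<open>Trading the summand from \<open>A j\<close> for a better one stays inside the set; this
  turns a larger value of \<phi> on \<open>A j\<close> into a smaller bound for \<phi> at
  \<open>w\<close>.\<close>

lemma weighted_sums_replace:
  assumes "w \<in> weighted_sums A" "\<And>i. 0 \<in> A i"
  obtains s where "s \<in> A j" "\<And>s'. s' \<in> A j \<Longrightarrow> w + (1/2)^j *\<^sub>R (s' - s) \<in> weighted_sums A"
proof -
  obtain b k s where w: "w = b + (\<Sum>i<k. (1/2)^i *\<^sub>R s i)" and b: "norm b \<le> 1" and s: "\<And>i. s i \<in> A i"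
    using assms(1) by (auto simp: weighted_sums_def)
  \<comment> \<open>Padding with zeros makes the index \<open>j\<close> occur even if the given sum
    ends before it.\<close>
  define k' where "k' = max k (Suc j)"
  define t where "t i = (if i < k then s i else 0)" for i
  have tA: "t i \<in> A i" for i using s assms(2) by (simp add: t_def)
  have "(\<Sum>i<k. (1/2)^i *\<^sub>R s i) = (\<Sum>i<k'. (1/2)^i *\<^sub>R t i)"
    by (rule sum.mono_neutral_cong_left) (auto simp: k'_def t_def)
  then have w': "w = b + (\<Sum>i<k'. (1/2)^i *\<^sub>R t i)" using w by simp
  show ?thesis
  proof (rule that[of "t j"])
    fix s' assume s': "s' \<in> A j"
    have j: "j \<in> {..<k'}" by (simp add: k'_def)
    have "(\<Sum>i<k'. (1/2)^i *\<^sub>R (t(j := s')) i) = (1/2)^j *\<^sub>R s' + (\<Sum>i\<in>{..<k'} - {j}. (1/2)^i *\<^sub>R t i)"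
      using j by (subst sum.remove[of _ j]) auto
    moreover have "(\<Sum>i<k'. (1/2)^i *\<^sub>R t i) = (1/2)^j *\<^sub>R t j + (\<Sum>i\<in>{..<k'} - {j}. (1/2)^i *\<^sub>R t i)"
      using j by (intro sum.remove) auto
    ultimately have "w + (1/2)^j *\<^sub>R (s' - t j) = b + (\<Sum>i<k'. (1/2)^i *\<^sub>R (t(j := s')) i)"
      using w' by (simp add: scaleR_diff_right)
    then show "w + (1/2)^j *\<^sub>R (s' - t j) \<in> weighted_sums A"
      unfolding weighted_sums_def using b tA s'
      by (intro CollectI exI[of _ b] exI[of _ k'] exI[of _ "t(j := s')"]) auto
  qed (rule tA)
qed

text \<open>Some \<open>sup\<^bsub>A j\<^esub>\<close> with \<open>j \<in> I\<close> grows by \<open>\<gamma>\<close> from \<open>u\<close> to any \<open>\<phi>\<close> that is weakly close to \<open>u\<close>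
  but separated from it by a vector \<open>v\<close> in the kernel of \<open>u\<close>.\<close>

definition asymptotic_gain :: "(nat \<Rightarrow> 'b::real_normed_vector set) \<Rightarrow> real \<Rightarrow> real \<Rightarrow> real \<Rightarrow> nat set \<Rightarrow> bool" where
  "asymptotic_gain A M \<epsilon> \<gamma> I \<longleftrightarrow> (\<forall>u. linear u \<longrightarrow> (\<forall>y. \<bar>u y\<bar> \<le> norm y) \<longrightarrow>
     (\<exists>j\<in>I. \<exists>T \<delta>. finite T \<and> 0 < \<delta> \<and>
       (\<forall>\<phi> v. linear \<phi> \<longrightarrow> (\<forall>y. \<bar>\<phi> y\<bar> \<le> norm y) \<longrightarrow> norm v \<le> M \<longrightarrow> u v = 0 \<longrightarrow> \<epsilon> \<le> \<phi> v \<longrightarrow>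
         (\<forall>t\<in>T. \<bar>\<phi> t - u t\<bar> < \<delta>) \<longrightarrow> (\<exists>s\<in>A j. \<forall>s'\<in>A j. u s' + \<gamma> \<le> \<phi> s))))"

text \<open>If smoothness fails at \<open>x\<close>, functionals of the polar that exceed
  \<open>1 + \<epsilon> * \<tau>\<close> at \<open>x + \<tau> v\<close>, with \<open>v\<close> in
  ever smaller kernels, accumulate at some \<open>u\<close> with
  \<open>u x \<ge> 1 - \<tau>\<close>. The gain forces \<open>u \<le> 1 - h\<close> on the whole
  set, so \<open>(1 + h) u\<close> is still in the polar and
  \<open>(1 + h) * (1 - \<tau>) \<le> 1\<close>, against
  \<open>\<tau> < h / (1 + h)\<close>.\<close>

lemma asymptotic_gain_AUS:
  fixes A :: "nat \<Rightarrow> 'b::real_normed_vector set"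
  assumes zero: "\<And>i. 0 \<in> A i" and sym: "\<And>i a. a \<in> A i \<Longrightarrow> - a \<in> A i"
    and bound: "\<And>i a. a \<in> A i \<Longrightarrow> norm a \<le> \<Lambda>"
    and gain: "\<And>\<epsilon>. 0 < \<epsilon> \<Longrightarrow> \<exists>\<gamma>>0. \<exists>I. finite I \<and> asymptotic_gain A (1 + 2 * \<Lambda>) \<epsilon> \<gamma> I"
  shows "equivalent_norm (polar_norm (weighted_sums A))" "AUS (polar_norm (weighted_sums A))"
proof -
  define W where "W = weighted_sums A"
  have W: "cball 0 1 \<subseteq> W" "W \<subseteq> cball 0 (1 + 2 * \<Lambda>)" "\<forall>w\<in>W. - w \<in> W" "0 < 1 + 2 * \<Lambda>"
    unfolding W_def using weighted_sums_props[of A \<Lambda>] zero sym bound by blast+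
  note upper = polar_upper[OF W(1,2,3,4)]
  note le_norm = polar_le_norm[OF W(1,2,3,4)]
  show N: "equivalent_norm (polar_norm (weighted_sums A))"
    unfolding W_def[symmetric] by (rule polar_norm_equivalent[OF W(1,2,3,4)])
  show "AUS (polar_norm (weighted_sums A))" unfolding W_def[symmetric]
  proof (rule AUS_I)
    show "equivalent_norm (polar_norm W)" using N by (simp add: W_def)
    fix \<epsilon> :: real assume \<epsilon>: "0 < \<epsilon>"
    obtain \<gamma> I where \<gamma>: "0 < \<gamma>" and I: "finite I" and g: "asymptotic_gain A (1 + 2 * \<Lambda>) \<epsilon> \<gamma> I"
      using gain[OF \<epsilon>] by blast
    obtain m where m: "\<And>i. i \<in> I \<Longrightarrow> i \<le> m" using finite_nat_set_iff_bounded_le I by auto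
    \<comment> \<open>A gain \<gamma> in a term \<open>j \<le> m\<close> weighs at least
      \<open>(1/2)^m * \<gamma> = 2 * h\<close>; one \<open>h\<close> is set aside for the errors of
      weak approximation.\<close>
    define h where "h = \<gamma> * (1/2)^m / 2"
    have h: "0 < h" using \<gamma> by (simp add: h_def)
    have "\<exists>Y\<in>cof. \<forall>v\<in>Y. polar_norm W v = 1 \<longrightarrow> polar_norm W (x + \<tau> *\<^sub>R v) \<le> 1 + \<epsilon> * \<tau>"
      if \<tau>: "0 < \<tau>" "\<tau> < h / (1 + h)" and x: "polar_norm W x = 1" for \<tau> x
    proof (rule ccontr)
      assume neg: "\<not> ?thesis"
      define Y where "Y J = {y::'b. \<forall>\<psi>\<in>J. bounded_linear \<psi> \<longrightarrow> \<psi> y = (0::real)}" for J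
      have "\<exists>\<phi> v. v \<in> Y J \<and> polar_norm W v = 1 \<and> \<phi> \<in> polar W \<and> 1 + \<epsilon> * \<tau> < \<phi> (x + \<tau> *\<^sub>R v)" if "finite J" for J
      proof -
        have "Y J \<in> cof" unfolding Y_def by (rule common_kernel_cof[OF that])
        then obtain v where "v \<in> Y J" "polar_norm W v = 1" "1 + \<epsilon> * \<tau> < polar_norm W (x + \<tau> *\<^sub>R v)"
          using neg by (meson not_le)
        then show ?thesis using less_polar_norm[OF W(1,2,3,4)] by blast
      qed
      then obtain \<phi> v where v: "\<And>J. finite J \<Longrightarrow> v J \<in> Y J" "\<And>J. finite J \<Longrightarrow> polar_norm W (v J) = 1"
        and \<phi>: "\<And>J. finite J \<Longrightarrow> \<phi> J \<in> polar W"
        and large: "\<And>J. finite J \<Longrightarrow> 1 + \<epsilon> * \<tau> < \<phi> J (x + \<tau> *\<^sub>R v J)"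
        by metis
      have lin: "linear (\<phi> J)" if "finite J" for J using \<phi>[OF that] by (simp add: polar_def)
      have large': "1 + \<epsilon> * \<tau> < \<phi> J x + \<tau> * \<phi> J (v J)" if "finite J" for J
        using large[OF that] by (simp add: linear_add[OF lin[OF that]] linear_scale[OF lin[OF that]])
      \<comment> \<open>Since \<open>\<phi> J x \<le> 1\<close>, the excess
        \<open>\<epsilon> * \<tau>\<close> must come from \<open>v J\<close>; conversely
        \<open>\<phi> J (v J) \<le> 1\<close> leaves
        \<open>\<phi> J x \<ge> 1 - \<tau>\<close>.\<close>
      have \<phi>v: "\<epsilon> \<le> \<phi> J (v J)" if "finite J" for J
      proof -
        have "\<tau> * \<epsilon> < \<tau> * \<phi> J (v J)"
          using large'[OF that] upper[OF \<phi>[OF that], of x] x by (simp add: mult.commute)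
        then show ?thesis using \<tau> by simp
      qed
      have \<phi>x: "1 - \<tau> \<le> \<phi> J x" if "finite J" for J
      proof -
        have "\<tau> * \<phi> J (v J) \<le> \<tau> * 1"
          using upper[OF \<phi>[OF that], of "v J"] v(2)[OF that] \<tau> by (intro mult_left_mono) auto
        moreover have "0 < \<epsilon> * \<tau>" using \<epsilon> \<tau> by simp
        ultimately show ?thesis using large'[OF that] by linarith
      qed
      have "\<forall>J y. finite J \<longrightarrow> \<bar>\<phi> J y\<bar> \<le> norm y" using le_norm[OF \<phi>] by blast
      from functional_cluster_point[OF this] obtain u where ucl: "(\<forall>y. \<bar>u y\<bar> \<le> norm y) \<and>
        (\<forall>T \<delta> J0. finite T \<longrightarrow> 0 < \<delta> \<longrightarrow> finite J0 \<longrightarrow>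
          (\<exists>J. finite J \<and> J0 \<subseteq> J \<and> (\<forall>t\<in>T. \<bar>\<phi> J t - u t\<bar> < \<delta>)))" ..
      then have u: "\<And>y. \<bar>u y\<bar> \<le> norm y" by blast
      have near: "\<exists>J. finite J \<and> J0 \<subseteq> J \<and> (\<forall>t\<in>T. \<bar>\<phi> J t - u t\<bar> < \<delta>)"
        if "finite T" "0 < \<delta>" "finite J0" for T \<delta> J0
        using ucl that by simp
      have ulin: "linear u"
      proof (rule linear_cluster_point)
        fix T :: "'b set" and \<delta> :: real assume "finite T" "0 < \<delta>"
        then obtain J where "finite J" "\<forall>t\<in>T. \<bar>\<phi> J t - u t\<bar> < \<delta>" using near[of T \<delta> "{}"] by auto
        then show "\<exists>\<psi>. linear \<psi> \<and> (\<forall>t\<in>T. \<bar>\<psi> t - u t\<bar> < \<delta>)" using lin by blast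
      qed
      have ux: "1 - \<tau> \<le> u x"
      proof (rule field_le_epsilon)
        fix e :: real assume "0 < e"
        then obtain J where "finite J" "\<bar>\<phi> J x - u x\<bar> < e" using near[of "{x}" e "{}"] by auto
        then show "1 - \<tau> \<le> u x + e" using \<phi>x[of J] by linarith
      qed
      obtain j T \<delta> where j: "j \<in> I" and T: "finite T" and \<delta>: "0 < \<delta>"
        and gj: "\<forall>\<phi> v. linear \<phi> \<longrightarrow> (\<forall>y. \<bar>\<phi> y\<bar> \<le> norm y) \<longrightarrow> norm v \<le> 1 + 2 * \<Lambda> \<longrightarrow> u v = 0 \<longrightarrow> \<epsilon> \<le> \<phi> v \<longrightarrow>
         (\<forall>t\<in>T. \<bar>\<phi> t - u t\<bar> < \<delta>) \<longrightarrow> (\<exists>s\<in>A j. \<forall>s'\<in>A j. u s' + \<gamma> \<le> \<phi> s)"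
        using g[unfolded asymptotic_gain_def, rule_format, OF ulin u] by auto
      have uW: "u w \<le> 1 - h" if w: "w \<in> W" for w
      proof -
        obtain s where s: "s \<in> A j" and repl: "\<And>s'. s' \<in> A j \<Longrightarrow> w + (1/2)^j *\<^sub>R (s' - s) \<in> W"
          using weighted_sums_replace[of w A j] w zero unfolding W_def by blast
        define \<eta> where "\<eta> = min \<delta> (h / 2)"
        have \<eta>: "0 < \<eta>" "\<eta> \<le> \<delta>" "\<eta> \<le> h / 2" using \<delta> h by (auto simp: \<eta>_def)
        \<comment> \<open>Demanding \<open>u \<in> J\<close> puts \<open>v J\<close> into the kernel
          of \<open>u\<close>, as \<open>asymptotic_gain\<close> requires.\<close>
        obtain J where J: "finite J" "u \<in> J" and close: "\<And>t. t \<in> T \<union> {w, s} \<Longrightarrow> \<bar>\<phi> J t - u t\<bar> < \<eta>"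
          using near[of "T \<union> {w, s}" \<eta> "{u}"] T \<eta> by auto
        have uv: "u (v J) = 0"
          using v(1)[OF J(1)] J(2) bounded_linear_dominated[OF ulin u] by (simp add: Y_def)
        have nv: "norm (v J) \<le> 1 + 2 * \<Lambda>"
          using norm_le_polar_norm[OF W(1,2,3,4), of "v J"] v(2)[OF J(1)] by simp
        have "\<exists>s\<in>A j. \<forall>s'\<in>A j. u s' + \<gamma> \<le> \<phi> J s"
        proof -
          have "\<forall>t\<in>T. \<bar>\<phi> J t - u t\<bar> < \<delta>" using close \<eta> by force
          then show ?thesis
            using gj[rule_format, of "\<phi> J" "v J"] lin[OF J(1)] le_norm[OF \<phi>[OF J(1)]] nv uv \<phi>v[OF J(1)] by blast
        qed
        then obtain s' where s': "s' \<in> A j" "u s + \<gamma> \<le> \<phi> J s'" using s by blast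
        have "\<phi> J (w + (1/2)^j *\<^sub>R (s' - s)) \<le> 1" using \<phi>[OF J(1)] repl[OF s'(1)] by (simp add: polar_def)
        then have "\<phi> J w + (1/2)^j * (\<phi> J s' - \<phi> J s) \<le> 1"
          by (simp add: linear_add[OF lin[OF J(1)]] linear_diff[OF lin[OF J(1)]] linear_scale[OF lin[OF J(1)]])
        moreover have "(1/2)^j * (\<gamma> - \<eta>) \<le> (1/2)^j * (\<phi> J s' - \<phi> J s)"
          using s'(2) close[of s] by (intro mult_left_mono) (auto simp: abs_less_iff)
        moreover have "(1/2)^m * \<gamma> \<le> (1/2::real)^j * \<gamma>"
          using m[OF j] \<gamma> by (intro mult_right_mono power_decreasing) auto
        moreover have "(1/2)^j * \<eta> \<le> 1 * \<eta>" using \<eta> by (intro mult_right_mono) (auto simp: power_le_one)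
        moreover have "(1/2)^m * \<gamma> = 2 * h" by (simp add: h_def)
        ultimately have "\<phi> J w + 2 * h - \<eta> \<le> 1" by (simp add: right_diff_distrib)
        then show ?thesis using close[of w] \<eta> by (simp add: abs_less_iff)
      qed
      have "(\<lambda>y. (1 + h) *\<^sub>R u y) \<in> polar W"
      proof -
        have "(1 + h) * u w \<le> 1" if "w \<in> W" for w
        proof -
          have "(1 + h) * u w \<le> (1 + h) * (1 - h)" using uW[OF that] h by (intro mult_left_mono) auto
          also have "\<dots> = 1 - h * h" by (simp add: algebra_simps)
          finally show ?thesis using h by (smt (verit) mult_pos_pos)
        qed
        then show ?thesis using linear_compose_scale_right[OF ulin, of "1 + h"] by (simp add: polar_def)
      qed
      from upper[OF this, of x] have "(1 + h) * u x \<le> 1" using x by simp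
      moreover have "(1 + h) * (1 - \<tau>) \<le> (1 + h) * u x" using ux h by (intro mult_left_mono) auto
      moreover have "(1 + h) * \<tau> < h" using \<tau> h by (simp add: field_simps)
      ultimately show False by (simp add: algebra_simps)
    qed
    then show "\<exists>t0>0. \<forall>\<tau>. 0 < \<tau> \<longrightarrow> \<tau> < t0 \<longrightarrow> (\<forall>x. polar_norm W x = 1 \<longrightarrow>
        (\<exists>Y\<in>cof. \<forall>v\<in>Y. polar_norm W v = 1 \<longrightarrow> polar_norm W (x + \<tau> *\<^sub>R v) \<le> 1 + \<epsilon> * \<tau>))"
      using h by (intro exI[of _ "h / (1 + h)"]) simp
  qed
qed

section \<open>Asymptotically inverse maps\<close>

lemma coarse_lipschitz_const:
  fixes f :: "'a::real_normed_vector \<Rightarrow> 'b::real_normed_vector" and g :: "'b \<Rightarrow> 'a"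
  assumes "coarse_lipschitz f" "coarse_lipschitz g"
  obtains L where "1 \<le> L" "\<And>x y. norm (f x - f y) \<le> L * norm (x - y) + L"
    "\<And>x y. norm (g x - g y) \<le> L * norm (x - y) + L"
proof -
  obtain A where A: "\<And>x y. norm (f x - f y) \<le> A * norm (x - y) + A"
    using assms(1) by (auto simp: coarse_lipschitz_def dist_norm)
  obtain B where B: "\<And>x y. norm (g x - g y) \<le> B * norm (x - y) + B"
    using assms(2) by (auto simp: coarse_lipschitz_def dist_norm)
  define L where "L = max 1 (max A B)"
  have "A * t + A \<le> L * t + L" "B * t + B \<le> L * t + L" if "0 \<le> t" for t
    using that by (auto simp: L_def intro!: add_mono mult_right_mono)
  then show ?thesis
    using that[of L] order_trans[OF A] order_trans[OF B] by (simp add: L_def)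
qed

text \<open>The limit controls the error only far from \<open>x0\<close>. On the remaining ball, and
  in the bounded case where closeness holds by convention, \<open>growth\<close> bounds it by a
  constant that goes into \<open>R\<close>.\<close>

lemma asymptotically_close_id_bound:
  fixes h :: "'a::real_normed_vector \<Rightarrow> 'a"
  assumes close: "asymptotically_close h id"
    and growth: "\<And>x. norm (h x - x) \<le> A * norm x + B" and A: "0 \<le> A"
    and e: "0 < \<epsilon>"
  obtains R where "0 \<le> R" "\<And>x. norm (h x - x) \<le> \<epsilon> * norm x + R"
proof -
  have loc: "norm (h x - x) \<le> \<epsilon> * norm x + (A * \<bar>d\<bar> + \<bar>B\<bar> + \<epsilon> * a)" if "norm x \<le> d" "0 \<le> a" for x d a
  proof -
    have "A * norm x \<le> A * \<bar>d\<bar>" using that A by (intro mult_left_mono) auto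
    moreover have "0 \<le> \<epsilon> * norm x" "0 \<le> \<epsilon> * a" using e that by auto
    ultimately show ?thesis using growth[of x] by linarith
  qed
  consider "bounded (UNIV :: 'a set)"
    | x0 :: 'a where "((\<lambda>x. dist (h x) x / dist x x0) \<longlongrightarrow> 0) (filtercomap (\<lambda>x. dist x x0) at_top)"
    using close unfolding asymptotically_close_def by auto
  then show ?thesis
  proof cases
    case 1
    then obtain d where "\<And>x::'a. norm x \<le> d" unfolding bounded_iff by auto
    then show ?thesis using loc[of _ d 0] A that[of "A * \<bar>d\<bar> + \<bar>B\<bar> + \<epsilon> * 0"] by simp
  next
    case 2
    have "eventually (\<lambda>x. dist (dist (h x) x / dist x x0) 0 < \<epsilon>) (filtercomap (\<lambda>x. dist x x0) at_top)"
      by (rule tendstoD[OF 2 e])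
    then obtain b where b: "\<And>x. b \<le> dist x x0 \<Longrightarrow> dist (h x) x / dist x x0 < \<epsilon>"
      unfolding eventually_filtercomap eventually_at_top_linorder by (auto simp: dist_real_def)
    define d where "d = norm x0 + max b 1"
    have "norm (h x - x) \<le> \<epsilon> * norm x + (A * \<bar>d\<bar> + \<bar>B\<bar> + \<epsilon> * norm x0)" for x
    proof (cases "norm x \<le> d")
      case False
      have "norm x - norm x0 \<le> dist x x0" by (simp add: dist_norm norm_triangle_ineq2)
      then have ge: "b \<le> dist x x0" "0 < dist x x0" using False by (auto simp: d_def)
      then have "norm (h x - x) \<le> \<epsilon> * dist x x0"
        using b[OF ge(1)] by (simp add: dist_norm divide_less_eq)
      also have "\<dots> \<le> \<epsilon> * (norm x + norm x0)"
        using e by (intro mult_left_mono) (auto simp: dist_norm norm_triangle_ineq4)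
      finally have "norm (h x - x) \<le> \<epsilon> * (norm x + norm x0)" .
      moreover have "0 \<le> A * \<bar>d\<bar>" using A by simp
      ultimately show ?thesis unfolding distrib_left by linarith
    qed (use loc[of x d "norm x0"] in simp)
    then show ?thesis using that[of "A * \<bar>d\<bar> + \<bar>B\<bar> + \<epsilon> * norm x0"] A e by simp
  qed
qed

lemma coarse_composition_growth:
  fixes f :: "'a::real_normed_vector \<Rightarrow> 'b::real_normed_vector" and g :: "'b \<Rightarrow> 'a"
  assumes f: "\<And>x y. norm (f x - f y) \<le> L * norm (x - y) + L"
    and g: "\<And>x y. norm (g x - g y) \<le> L * norm (x - y) + L" and L: "1 \<le> L"
  shows "norm ((g \<circ> f) x - x) \<le> (L * L + 1) * norm x + (L * L + L + norm (g (f 0)))"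
proof -
  have "norm (g (f x) - x) \<le> norm (g (f x) - g (f 0)) + norm (g (f 0)) + norm x"
    using norm_triangle_ineq[of "g (f x) - g (f 0)" "g (f 0)"] norm_triangle_ineq4[of "g (f x)" x] by simp
  moreover have "L * norm (f x - f 0) \<le> L * (L * norm x + L)"
    using f[of x 0] L by (intro mult_left_mono) auto
  ultimately show ?thesis using g[of "f x" "f 0"] by (simp add: algebra_simps)
qed

locale asymptotic_equivalence =
  fixes f :: "'a::real_normed_vector \<Rightarrow> 'b::real_normed_vector" and g :: "'b \<Rightarrow> 'a" and L :: real
  assumes f: "\<And>x y. norm (f x - f y) \<le> L * norm (x - y) + L"
    and g: "\<And>x y. norm (g x - g y) \<le> L * norm (x - y) + L" and L: "1 \<le> L"
    and gf: "asymptotically_close (g \<circ> f) id" and fg: "asymptotically_close (f \<circ> g) id"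
begin

lemma gf_bound:
  assumes "0 < \<epsilon>"
  obtains R where "0 \<le> R" "\<And>x. norm (g (f x) - x) \<le> \<epsilon> * norm x + R"
  using asymptotically_close_id_bound[OF gf coarse_composition_growth[OF f g L] _ assms] L by auto

lemma fg_bound:
  assumes "0 < \<epsilon>"
  obtains R where "0 \<le> R" "\<And>x. norm (f (g x) - x) \<le> \<epsilon> * norm x + R"
  using asymptotically_close_id_bound[OF fg coarse_composition_growth[OF g f L] _ assms] L by auto

text \<open>\<open>gorelik_principle\<close> is applied to
  \<open>a \<mapsto> g (f (m + a) + y) - m\<close>, whose displacement is small because
  \<open>g \<circ> f\<close> is close to the identity; then \<open>f \<circ> g\<close> leads back to
  \<open>f (m + a) + y\<close>. The finite set consists of the points \<open>f (m + a)\<close> and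
  serves every \<open>y\<close>. The bound \<open>K * r\<close> on \<open>m\<close> turns errors
  relative to the norm into errors relative to \<open>r\<close>.\<close>

lemma asymptotic_gorelik_principle:
  assumes K: "0 \<le> K" and \<zeta>: "0 < \<zeta>"
  obtains r0 where "0 < r0" "\<And>r m V. r0 \<le> r \<Longrightarrow> norm m \<le> K * r \<Longrightarrow> V \<in> cof \<Longrightarrow>
    \<exists>F. finite F \<and> (\<forall>y. norm y \<le> r / (8 * L) \<longrightarrow>
      (\<exists>z\<in>V. norm z \<le> 3 * r \<and> (\<exists>t\<in>F. norm (f (m + z) - (t + y)) \<le> \<zeta> * r)))"
proof -
  have K2: "0 < K + 2" "0 < L * (K + 2) + 1" using K L by (auto intro: add_nonneg_pos)
  \<comment> \<open>At points of norm at most \<open>(K + 2) * r\<close> the defect of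
    \<open>g \<circ> f\<close> is at most \<open>r / 8 + R1\<close>; with
    \<open>L * norm y + L \<le> r / 8 + L\<close> it stays within the displacement
    \<open>r / 2\<close>. The choice of \<open>e2\<close> leaves \<open>\<zeta> * r / 4\<close> plus
    a constant for \<open>f \<circ> g\<close>.\<close>
  define e1 where "e1 = 1 / (8 * (K + 2))"
  have e1: "0 < e1" "e1 * (K + 2) = 1/8" using K2 by (auto simp: e1_def)
  define e2 where "e2 = \<zeta> / (4 * (L * (K + 2) + 1))"
  have "\<zeta> / (4 * Z) * Z = \<zeta> / 4" if "0 < Z" for Z using that by simp
  then have e2: "0 < e2" "e2 * (L * (K + 2) + 1) = \<zeta> / 4"
    unfolding e2_def using K2(2) \<zeta> by (blast intro: divide_pos_pos mult_pos_pos zero_less_numeral)+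
  obtain R1 where R1: "0 \<le> R1" "\<And>x. norm (g (f x) - x) \<le> e1 * norm x + R1" using gf_bound[OF e1(1)] by blast
  obtain R2 where R2: "0 \<le> R2" "\<And>x. norm (f (g x) - x) \<le> e2 * norm x + R2" using fg_bound[OF e2(1)] by blast
  \<comment> \<open>The oscillation of \<open>a \<mapsto> g (f (m + a) + y)\<close> over points at
    distance at most 2. It does not depend on \<open>r\<close>, so \<open>r0\<close> can absorb it
    along with the other additive constants.\<close>
  define \<omega> where "\<omega> = L * (L * 2 + L) + L"
  define E where "E = L * \<omega> + L + e2 * (norm (f 0) + L) + R2"
  have \<omega>: "0 \<le> \<omega>" using L by (simp add: \<omega>_def)
  have E: "0 \<le> E" using L \<omega> e2 R2 by (simp add: E_def)
  define r0 where "r0 = 1 + 4 * (L + R1) + 2 * \<omega> + 2 * E / \<zeta>"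
  have nn: "0 \<le> L + R1" "0 \<le> 2 * E / \<zeta>" using L R1 E \<zeta> by auto
  show ?thesis
  proof (rule that[of r0])
    show "0 < r0" using nn \<omega> by (simp add: r0_def)
    fix r and m :: 'a and V assume r: "r0 \<le> r" and m: "norm m \<le> K * r" and V: "V \<in> (cof :: 'a set set)"
    have rp: "0 < r" "L + R1 \<le> r / 4" "\<omega> \<le> r / 2" using r nn \<omega> by (auto simp: r0_def)
    have "2 * E / \<zeta> \<le> r" using r nn \<omega> by (simp add: r0_def)
    then have Er: "E \<le> \<zeta> * r / 2" using \<zeta> by (simp add: field_simps)
    obtain F where F: "finite F" "F \<subseteq> cball 0 (2 * r)"
      and gor: "\<And>\<phi> \<omega>. (\<And>a. a \<in> F \<Longrightarrow> norm (\<phi> a - a) \<le> r / 2) \<Longrightarrow>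
        (\<And>a b. a \<in> F \<Longrightarrow> b \<in> F \<Longrightarrow> norm (a - b) \<le> 2 \<Longrightarrow> norm (\<phi> a - \<phi> b) \<le> \<omega>) \<Longrightarrow>
        \<exists>a\<in>F. \<exists>z\<in>V. norm (z - \<phi> a) \<le> \<omega>"
      using gorelik_principle[OF V rp(1)] by metis
    have ma: "norm (m + a) \<le> (K + 2) * r" if "a \<in> F" for a
    proof -
      have "norm a \<le> 2 * r" using F that by auto
      then show ?thesis using m norm_triangle_ineq[of m a] by (simp add: distrib_right)
    qed
    have "\<exists>z\<in>V. norm z \<le> 3 * r \<and> (\<exists>t\<in>(\<lambda>a. f (m + a)) ` F. norm (f (m + z) - (t + y)) \<le> \<zeta> * r)"
      if y: "norm y \<le> r / (8 * L)" for y
    proof -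
      have Ly: "L * norm y \<le> r / 8" using y L by (simp add: field_simps)
      define \<phi> where "\<phi> a = g (f (m + a) + y) - m" for a
      have near: "norm (\<phi> a - a) \<le> r / 2" if a: "a \<in> F" for a
      proof -
        have "norm (\<phi> a - a) \<le> norm (g (f (m + a) + y) - g (f (m + a))) + norm (g (f (m + a)) - (m + a))"
          using norm_triangle_ineq[of "g (f (m + a) + y) - g (f (m + a))" "g (f (m + a)) - (m + a)"]
          by (simp add: \<phi>_def algebra_simps)
        moreover have "norm (g (f (m + a) + y) - g (f (m + a))) \<le> L * norm y + L"
          using g[of "f (m + a) + y" "f (m + a)"] by simp
        moreover have "e1 * norm (m + a) \<le> e1 * ((K + 2) * r)" using ma[OF a] e1 by (intro mult_left_mono) auto
        moreover have "e1 * ((K + 2) * r) = r / 8" unfolding mult.assoc[symmetric] e1(2) by simp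
        ultimately show ?thesis using R1(2)[of "m + a"] Ly rp by linarith
      qed
      have osc: "norm (\<phi> a - \<phi> b) \<le> \<omega>" if "norm (a - b) \<le> 2" for a b
      proof -
        have "norm (f (m + a) - f (m + b)) \<le> L * norm (a - b) + L" using f[of "m + a" "m + b"] by simp
        also have "\<dots> \<le> L * 2 + L" using that L by (intro add_mono mult_left_mono) auto
        finally have "L * norm (f (m + a) - f (m + b)) \<le> L * (L * 2 + L)" using L by (intro mult_left_mono) auto
        then show ?thesis using g[of "f (m + a) + y" "f (m + b) + y"] by (simp add: \<phi>_def \<omega>_def)
      qed
      obtain a z where a: "a \<in> F" and z: "z \<in> V" "norm (z - \<phi> a) \<le> \<omega>" using gor[of \<phi> \<omega>] near osc by blast
      have "norm a \<le> 2 * r" using F a by auto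
      then have "norm z \<le> 3 * r"
        using z(2) near[OF a] rp norm_triangle_ineq[of "z - \<phi> a" "\<phi> a"] norm_triangle_ineq[of "\<phi> a - a" a]
        by simp
      moreover have "norm (f (m + z) - (f (m + a) + y)) \<le> \<zeta> * r"
      proof -
        let ?w = "f (m + a) + y"
        have "norm (f (m + z) - f (g ?w)) \<le> L * norm (z - \<phi> a) + L"
          using f[of "m + z" "g ?w"] by (simp add: \<phi>_def algebra_simps)
        also have "\<dots> \<le> L * \<omega> + L" using z(2) L by (intro add_mono mult_left_mono) auto
        finally have 1: "norm (f (m + z) - f (g ?w)) \<le> L * \<omega> + L" .
        have "norm (f (m + a)) \<le> norm (f 0) + (L * norm (m + a) + L)"
          using f[of "m + a" 0] norm_triangle_ineq2[of "f (m + a)" "f 0"] by simp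
        moreover have "L * norm (m + a) \<le> L * ((K + 2) * r)" using ma[OF a] L by (intro mult_left_mono) auto
        moreover have "norm y \<le> r"
        proof -
          have "1 * norm y \<le> L * norm y" using L by (intro mult_right_mono) auto
          then show ?thesis using Ly rp by linarith
        qed
        ultimately have "norm ?w \<le> (norm (f 0) + L) + (L * (K + 2) + 1) * r"
          using norm_triangle_ineq[of "f (m + a)" y] by (simp add: algebra_simps)
        then have "e2 * norm ?w \<le> e2 * ((norm (f 0) + L) + (L * (K + 2) + 1) * r)"
          using e2 by (intro mult_left_mono) auto
        also have "\<dots> = e2 * (norm (f 0) + L) + \<zeta> / 4 * r"
        proof -
          have "e2 * (A + Z * r) = e2 * A + (e2 * Z) * r" for A Z by (simp add: algebra_simps)
          from this[of "norm (f 0) + L" "L * (K + 2) + 1"] show ?thesis unfolding e2(2) .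
        qed
        finally have 2: "norm (f (g ?w) - ?w) \<le> e2 * (norm (f 0) + L) + \<zeta> / 4 * r + R2"
          using R2(2)[of ?w] by linarith
        have "norm (f (m + z) - ?w) \<le> norm (f (m + z) - f (g ?w)) + norm (f (g ?w) - ?w)"
          using dist_triangle[of "f (m + z)" ?w "f (g ?w)"] by (simp only: dist_norm)
        also have "\<dots> \<le> E + \<zeta> * r / 4" using 1 2 by (simp add: E_def)
        also have "\<dots> \<le> \<zeta> * r" using Er mult_pos_pos[OF \<zeta> rp(1)] by linarith
        finally show ?thesis .
      qed
      ultimately show ?thesis using z a by blast
    qed
    then show "\<exists>F. finite F \<and> (\<forall>y. norm y \<le> r / (8 * L) \<longrightarrow>
      (\<exists>z\<in>V. norm z \<le> 3 * r \<and> (\<exists>t\<in>F. norm (f (m + z) - (t + y)) \<le> \<zeta> * r)))"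
      using F by (intro exI[of _ "(\<lambda>a. f (m + a)) ` F"]) simp
  qed
qed

end

section \<open>The renorming of the target\<close>

lemma small_drop:
  fixes \<sigma> :: "nat \<Rightarrow> real"
  assumes "\<sigma> 0 \<le> \<Lambda>" "0 \<le> \<sigma> N" "\<Lambda> \<le> real N * \<eta>" "0 < N"
  obtains j where "j < N" "\<sigma> j - \<sigma> (Suc j) \<le> \<eta>"
proof -
  have "\<exists>j<N. \<sigma> j - \<sigma> (Suc j) \<le> \<eta>"
  proof (rule ccontr)
    assume "\<not> ?thesis"
    then have "(\<Sum>j<N. \<eta>) < (\<Sum>j<N. \<sigma> j - \<sigma> (Suc j))"
      using assms(4) by (intro sum_strict_mono) (auto simp: not_le)
    then show False using assms by (simp add: sum_lessThan_telescope')
  qed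
  then show ?thesis using that by blast
qed

text \<open>The balance for one half of a pair at distance \<open>2 * D\<close>, with
  \<open>P\<close> its length and \<open>X\<close> the increment of the new functional along it. In
  units of \<open>\<beta> * b * D\<close>, the gain 1/2 loses 1/8 to the supremum being only nearly
  attained and at most 1/16 twice to the lengthening of the halves; the added slope needs at most
  1/8 of the remaining 1/4.\<close>

lemma gain_arithmetic:
  fixes \<sigma> \<theta> \<beta> b D P X :: real
  assumes "0 \<le> \<sigma>" "\<sigma> * \<theta> \<le> \<beta> / 16" "0 \<le> \<theta>" "\<theta> \<le> 1" "0 < b" "b \<le> 1/2" "0 < \<beta>" "0 < D"
    and X: "(\<sigma> - 2 * (\<beta> * b / 32)) * (2 * D) - \<sigma> * ((1 + \<theta> * b) * D) + \<beta> * b * D / 2 \<le> X"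
    and P: "P \<le> (1 + \<theta> * b) * D"
  shows "(\<sigma> + \<beta> * b / 16) * P \<le> X"
proof -
  have "0 \<le> \<sigma> + \<beta> * b / 16" using assms by simp
  then have "(\<sigma> + \<beta> * b / 16) * P \<le> (\<sigma> + \<beta> * b / 16) * ((1 + \<theta> * b) * D)"
    using P by (rule mult_left_mono[rotated])
  also have "\<dots> = \<sigma> * D + (\<sigma> * \<theta>) * (b * D) + \<beta> * b * D / 16 + (\<theta> * b) * (\<beta> * b * D) / 16"
    by (simp add: field_simps)
  also have "\<dots> \<le> X"
  proof -
    have "(\<sigma> * \<theta>) * (b * D) \<le> \<beta> / 16 * (b * D)" using assms by (intro mult_right_mono) auto
    moreover have "\<theta> * b \<le> 1 * 1" using assms by (intro mult_mono) auto
    then have "(\<theta> * b) * (\<beta> * b * D) \<le> 1 * (\<beta> * b * D)" using assms by (intro mult_right_mono) auto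
    moreover have "(\<sigma> - 2 * (\<beta> * b / 32)) * (2 * D) - \<sigma> * ((1 + \<theta> * b) * D) + \<beta> * b * D / 2
      = \<sigma> * D - (\<sigma> * \<theta>) * (b * D) + 3 * (\<beta> * b * D) / 8"
      by (simp add: field_simps)
    moreover have "0 < \<beta> * b * D" using assms by simp
    ultimately show ?thesis using X by (simp add: field_simps)
  qed
  finally show ?thesis .
qed

section \<open>Slopes between distant points and their suprema\<close>

locale smooth_source = asymptotic_equivalence f g L
  for f :: "'a::real_normed_vector \<Rightarrow> 'b::real_normed_vector" and g :: "'b \<Rightarrow> 'a" and L :: real +
  fixes p :: "'a \<Rightarrow> real" and c C :: real
  assumes p: "equivalent_norm p" and smooth: "AUS p" and c: "0 < c" and C: "0 < C"
    and p_lower: "\<And>x. c * norm x \<le> p x" and p_upper: "\<And>x. p x \<le> C * norm x"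
    and nontrivial: "\<exists>x::'a. x \<noteq> 0"
begin

text \<open>Both points of an admissible pair lie within \<open>R\<close> times their distance of the origin; only on
  this scale are the errors of \<open>g \<circ> f\<close> and \<open>f \<circ> g\<close> negligible. Passing to a midpoint
  costs a constant factor in \<open>R\<close> and \<open>s\<close>.\<close>

definition admissible :: "real \<Rightarrow> real \<Rightarrow> 'a \<Rightarrow> 'a \<Rightarrow> bool" where
  "admissible R s x y \<longleftrightarrow> s \<le> p (x - y) \<and> norm x \<le> R * p (x - y) \<and> norm y \<le> R * p (x - y)"

definition slope :: "'a \<Rightarrow> 'a \<Rightarrow> 'b" where
  "slope x y = (1 / p (x - y)) *\<^sub>R (f x - f y)"

text \<open>With base radius \<open>1 / c\<close> any \<open>x\<close> with
  \<open>p x \<ge> 8 ^ k\<close> forms an admissible pair with 0, so no family lacks pairs. The base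
  8 is the cost of a midpoint in either parameter. The element 0 makes all suprema nonnegative and
  is the neutral summand in \<open>weighted_sums\<close>.\<close>

definition slopes :: "nat \<Rightarrow> nat \<Rightarrow> 'b set" where
  "slopes a k = insert 0 {slope x y | x y. admissible (8 ^ a / c) (8 ^ k) x y}"

lemmas pD = equivalent_normD[OF p]

lemma p_commute: "p (x - y) = p (y - x)"
  using pD(5)[of "x - y"] by simp

lemma p_diff_ge: "p x - p y \<le> p (x - y)"
  using pD(4)[of "x - y" y] by simp

lemma admissible_sym: "admissible R s x y \<Longrightarrow> admissible R s y x"
  unfolding admissible_def p_commute[of x y] by blast

lemma slope_minus: "- slope x y = slope y x"
  unfolding slope_def p_commute[of x y] scaleR_minus_right[symmetric] minus_diff_eq ..

lemma slopes_minus: "s \<in> slopes a k \<Longrightarrow> - s \<in> slopes a k"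
proof -
  assume "s \<in> slopes a k"
  then consider "s = 0" | x y where "s = slope x y" "admissible (8 ^ a / c) (8 ^ k) x y"
    by (auto simp: slopes_def)
  then show ?thesis
  proof cases
    case 2
    then have "- s = slope y x" by (simp add: slope_minus)
    then show ?thesis using admissible_sym[OF 2(2)] unfolding slopes_def by blast
  qed (simp add: slopes_def)
qed

text \<open>At distances \<open>8 ^ k \<ge> 1\<close> the additive constant of the coarse Lipschitz
  bound is at most \<open>L\<close> times the distance, so all families share one bound.\<close>

lemma slope_norm_le: "s \<in> slopes a k \<Longrightarrow> norm s \<le> L / c + L"
proof -
  assume "s \<in> slopes a k"
  then consider "s = 0" | x y where "s = slope x y" "8 ^ k \<le> p (x - y)"
    by (auto simp: slopes_def admissible_def)
  then show ?thesis
  proof cases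
    case 1 then show ?thesis using L c by simp
  next
    case 2
    have P: "1 \<le> p (x - y)" using 2 one_le_power[of "8::real" k] by linarith
    have "norm (f x - f y) \<le> L * (p (x - y) / c) + L"
    proof -
      have "norm (x - y) \<le> p (x - y) / c" using p_lower[of "x - y"] c by (simp add: le_divide_eq mult.commute)
      then have "L * norm (x - y) \<le> L * (p (x - y) / c)" using L by (intro mult_left_mono) auto
      then show ?thesis using f[of x y] by linarith
    qed
    also have "\<dots> \<le> L * (p (x - y) / c) + L * p (x - y)" using L P by simp
    also have "\<dots> = (L / c + L) * p (x - y)" by (simp add: field_simps)
    finally show ?thesis using P 2 by (simp add: slope_def divide_le_eq)
  qed
qed

lemma admissible_exists: "\<exists>x y. admissible (8 ^ a / c) (8 ^ k) x y"
proof -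
  obtain x0 :: 'a where "x0 \<noteq> 0" using nontrivial by blast
  then have p0: "0 < p x0" using pD(1,2)[of x0] by (simp add: less_le)
  define x where "x = (8 ^ k / p x0) *\<^sub>R x0"
  have px: "p x = 8 ^ k" using p0 by (simp add: x_def pD(3))
  have "norm x \<le> 8 ^ k / c" using p_lower[of x] px c by (simp add: le_divide_eq mult.commute)
  also have "\<dots> \<le> 8 ^ a / c * p (x - 0)"
    using px c one_le_power[of "8::real" a] by (simp add: divide_right_mono)
  finally have "admissible (8 ^ a / c) (8 ^ k) x 0"
    unfolding admissible_def using px c by simp
  then show ?thesis by blast
qed

text \<open>Each half has \<open>p\<close>-length at least \<open>D / 2\<close>, a quarter of that
  of the pair, while the displaced midpoint has norm at most \<open>5/2 * R * D\<close>. So the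
  radius grows at most by a factor 5 and the scale shrinks at most by 4; 8 covers both.\<close>

lemma admissible_midpoint:
  assumes ad: "admissible R (8 * s) x y" and s: "0 < s" and R: "1 / c \<le> R"
    and D: "D = p (x - y) / 2" and z: "p z \<le> b * D" and b: "b \<le> 1/2"
  shows "admissible (8 * R) s x ((1/2) *\<^sub>R (x + y) + z)"
    "admissible (8 * R) s ((1/2) *\<^sub>R (x + y) + z) y"
proof -
  have main: "admissible (8 * R) s x ((1/2) *\<^sub>R (x + y) + z)"
    if ad: "admissible R (8 * s) x y" and D: "D = p (x - y) / 2" for x y
  proof -
    let ?w = "(1/2) *\<^sub>R (x + y) + z"
    have D4: "4 * s \<le> D" using ad D by (simp add: admissible_def)
    have bD: "p z \<le> D / 2"
    proof -
      have "b * D \<le> 1/2 * D" using b D4 s by (intro mult_right_mono) auto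
      then show ?thesis using z by simp
    qed
    have eq: "x - ?w = (1/2) *\<^sub>R (x - y) - z"
      by (simp add: algebra_simps flip: scaleR_add_left)
    have "p ((1/2) *\<^sub>R (x - y)) = D" using D by (simp add: pD(3))
    then have P: "D / 2 \<le> p (x - ?w)" unfolding eq using p_diff_ge[of "(1/2) *\<^sub>R (x - y)" z] bD by linarith
    have Rp: "0 < R" using R c by (meson divide_pos_pos less_le_trans zero_less_one)
    have nz: "norm z \<le> R * D / 2"
    proof -
      have "norm z \<le> (1 / c) * p z" using p_lower[of z] c by (simp add: field_simps)
      also have "\<dots> \<le> R * (D / 2)" using R bD Rp pD(1) by (intro mult_mono) auto
      finally show ?thesis by simp
    qed
    have "R * p (x - y) = 2 * (R * D)" using D by simp
    then have xy: "norm x \<le> 2 * (R * D)" "norm y \<le> 2 * (R * D)" using ad unfolding admissible_def by linarith+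
    have nw: "norm ?w \<le> norm x / 2 + norm y / 2 + norm z"
      using norm_triangle_ineq[of "(1/2) *\<^sub>R (x + y)" z] norm_triangle_ineq[of x y] by (simp add: add_divide_distrib)
    have RP: "R * (D / 2) \<le> R * p (x - ?w)" using P Rp by (intro mult_left_mono) auto
    have "0 < R * D" using Rp D4 s by simp
    then have "norm x \<le> 8 * (R * p (x - ?w))" "norm ?w \<le> 8 * (R * p (x - ?w))"
      using nz xy nw RP by simp_all
    then show ?thesis unfolding admissible_def using P D4 s by (simp add: mult.assoc)
  qed
  show "admissible (8 * R) s x ((1/2) *\<^sub>R (x + y) + z)" by (rule main[OF ad D])
  have "admissible (8 * R) s y ((1/2) *\<^sub>R (y + x) + z)"
    by (rule main[OF admissible_sym[OF ad]]) (simp only: D p_commute[of x y])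
  then show "admissible (8 * R) s ((1/2) *\<^sub>R (x + y) + z) y"
    unfolding add.commute[of y x] by (rule admissible_sym)
qed

text \<open>Smoothness concerns unit vectors and displacements of length exactly \<open>b\<close>.
  Scaling by \<open>D\<close> and convexity of \<open>p\<close> extend it to all shorter
  displacements, and symmetry of \<open>V\<close> gives \<open>h - z\<close>, so one subspace
  controls both halves of a pair.\<close>

lemma smooth_ball:
  assumes b: "0 < b" and \<theta>: "0 \<le> \<theta>"
    and sm: "\<And>x. p x = 1 \<Longrightarrow> \<exists>V\<in>cof. \<forall>v\<in>V. p v = 1 \<longrightarrow> p (x + b *\<^sub>R v) \<le> 1 + \<theta> * b"
    and D: "p h = D" "0 < D"
  obtains V where "V \<in> cof" "\<And>z. z \<in> V \<Longrightarrow> p z \<le> b * D \<Longrightarrow> p (h + z) \<le> (1 + \<theta> * b) * D"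
    "\<And>z. z \<in> V \<Longrightarrow> p z \<le> b * D \<Longrightarrow> p (h - z) \<le> (1 + \<theta> * b) * D"
proof -
  have "p ((1 / D) *\<^sub>R h) = 1" using D by (simp add: pD(3))
  then obtain V where V: "V \<in> cof" and sV: "\<And>v. v \<in> V \<Longrightarrow> p v = 1 \<Longrightarrow> p ((1 / D) *\<^sub>R h + b *\<^sub>R v) \<le> 1 + \<theta> * b"
    using sm by blast
  have sub: "subspace V" using V by (simp add: cof_def)
  have plus: "p (h + z) \<le> (1 + \<theta> * b) * D" if z: "z \<in> V" "p z \<le> b * D" for z
  proof (cases "z = 0")
    case True
    then show ?thesis using D b \<theta> by simp
  next
    case False
    then have pz: "0 < p z" using pD(1,2)[of z] by (simp add: less_le)
    define t where "t = p z / (b * D)"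
    have t: "0 < t" "t \<le> 1" using pz z b D by (auto simp: t_def)
    define v where "v = (1 / p z) *\<^sub>R z"
    have v: "v \<in> V" "p v = 1" using z sub pz by (auto simp: v_def subspace_scale pD(3))
    have bd: "p (h + (b * D) *\<^sub>R v) \<le> (1 + \<theta> * b) * D"
    proof -
      have "h + (b * D) *\<^sub>R v = D *\<^sub>R ((1 / D) *\<^sub>R h + b *\<^sub>R v)" using D by (simp add: scaleR_add_right mult.commute)
      then have "p (h + (b * D) *\<^sub>R v) = D * p ((1 / D) *\<^sub>R h + b *\<^sub>R v)" using D by (simp add: pD(3))
      then show ?thesis using sV[OF v] D by (simp add: mult.commute)
    qed
    have "t * (b * D) = p z" using b D by (simp add: t_def)
    then have "t *\<^sub>R ((b * D) *\<^sub>R v) = z" using pz by (simp add: v_def)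
    then have "h + z = (1 - t) *\<^sub>R h + t *\<^sub>R (h + (b * D) *\<^sub>R v)"
      by (simp add: scaleR_add_right scaleR_diff_left)
    then have "p (h + z) \<le> (1 - t) * p h + t * p (h + (b * D) *\<^sub>R v)"
      using pD(4)[of "(1 - t) *\<^sub>R h" "t *\<^sub>R (h + (b * D) *\<^sub>R v)"] t by (simp add: pD(3))
    also have "\<dots> \<le> (1 - t) * ((1 + \<theta> * b) * D) + t * ((1 + \<theta> * b) * D)"
      using bd D b \<theta> t by (intro add_mono mult_left_mono) auto
    finally show ?thesis by (simp add: algebra_simps)
  qed
  have "p (h - z) \<le> (1 + \<theta> * b) * D" if "z \<in> V" "p z \<le> b * D" for z
    using plus[of "- z"] that subspace_neg[OF sub] pD(5)[of z] by simp
  then show ?thesis using that V plus by blast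
qed

definition slope_family :: "nat \<Rightarrow> 'b set" where
  "slope_family i = (case prod_decode i of (a, k) \<Rightarrow> slopes a k)"

text \<open>Both halves of a near-extremal pair have length almost \<open>D\<close>, and under
  \<open>u\<close> neither can exceed the supremum, so each carries about half of the increment. A
  shift of the image of the midpoint by a multiple of \<open>v\<close> is invisible to
  \<open>u\<close> but not to \<phi>, and makes the half at \<open>x\<close> steeper for \<phi> than
  every slope in \<open>A j\<close> is for \<open>u\<close>.\<close>

lemma slope_family_gain:
  assumes \<epsilon>: "0 < \<epsilon>" and M: "0 < M"
  shows "\<exists>\<gamma>>0. \<exists>I. finite I \<and> asymptotic_gain slope_family M \<epsilon> \<gamma> I"
proof -
  define \<Lambda> where "\<Lambda> = L / c + L"
  have \<Lambda>: "0 < \<Lambda>" using L c by (simp add: \<Lambda>_def add_pos_pos)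
  \<comment> \<open>\<kappa> scales vectors of norm at most \<open>M\<close> into the ball of radius
    \<open>r / (8 * L)\<close> that Gorelik's principle reaches. Then \<beta> is such that the
    effect \<open>\<kappa> * r * \<epsilon>\<close> on \<phi> equals \<open>\<beta> * b * D\<close>
    for \<open>r = b * D / (3 * C)\<close>.\<close>
  define \<kappa> where "\<kappa> = 1 / (8 * L * M)"
  have \<kappa>: "0 < \<kappa>" using L M by (simp add: \<kappa>_def)
  define \<beta> where "\<beta> = \<kappa> * \<epsilon> / (3 * C)"
  have \<beta>: "0 < \<beta>" using \<kappa> \<epsilon> C by (simp add: \<beta>_def)
  define \<theta> where "\<theta> = min 1 (\<beta> / (16 * \<Lambda>))"
  have \<theta>: "0 < \<theta>" "\<theta> \<le> 1" "\<Lambda> * \<theta> \<le> \<beta> / 16"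
  proof -
    show "0 < \<theta>" "\<theta> \<le> 1" using \<beta> \<Lambda> by (auto simp: \<theta>_def)
    have "\<Lambda> * \<theta> \<le> \<Lambda> * (\<beta> / (16 * \<Lambda>))" using \<Lambda> by (intro mult_left_mono) (auto simp: \<theta>_def)
    then show "\<Lambda> * \<theta> \<le> \<beta> / 16" using \<Lambda> by simp
  qed
  obtain b where b: "0 < b" "b < 1/2"
    and sm: "\<And>x. p x = 1 \<Longrightarrow> \<exists>V\<in>cof. \<forall>v\<in>V. p v = 1 \<longrightarrow> p (x + b *\<^sub>R v) \<le> 1 + \<theta> * b"
    by (rule AUS_D[OF p smooth \<theta>(1), of "1/2"]) auto
  define \<eta> where "\<eta> = \<beta> * b / 32"
  have \<eta>: "0 < \<eta>" using \<beta> b by (simp add: \<eta>_def)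
  define \<gamma> where "\<gamma> = \<beta> * b / 16"
  have \<gamma>: "0 < \<gamma>" using \<beta> b by (simp add: \<gamma>_def)
  obtain N0 :: nat where N0: "\<Lambda> / \<eta> < real N0" using reals_Archimedean2 by blast
  define N where "N = Suc N0"
  have N: "\<Lambda> \<le> real N * \<eta>" "0 < N"
    using N0 \<eta> by (auto simp: N_def divide_less_eq algebra_simps)
  define \<zeta> where "\<zeta> = \<kappa> * \<epsilon> / 8"
  have \<zeta>: "0 < \<zeta>" using \<kappa> \<epsilon> by (simp add: \<zeta>_def)
  \<comment> \<open>Since \<open>D = 3 * C / b * r\<close>, this is the bound
    \<open>8 ^ N / c * (2 * D)\<close> on midpoints, valid on all scales, expressed through
    \<open>r\<close>. In the same way \<open>k0\<close> guarantees
    \<open>r \<ge> r0\<close>.\<close>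
  define K where "K = 8 ^ N / c * 2 * (3 * C / b)"
  have K: "0 \<le> K" using c C b by (simp add: K_def)
  obtain r0 where r0: "0 < r0" and gor: "\<And>r m V. r0 \<le> r \<Longrightarrow> norm m \<le> K * r \<Longrightarrow> V \<in> cof \<Longrightarrow>
    \<exists>F. finite F \<and> (\<forall>y. norm y \<le> r / (8 * L) \<longrightarrow>
      (\<exists>z\<in>V. norm z \<le> 3 * r \<and> (\<exists>t\<in>F. norm (f (m + z) - (t + y)) \<le> \<zeta> * r)))"
    using asymptotic_gorelik_principle[OF K \<zeta>] by blast
  obtain k0 :: nat where k0: "r0 * (3 * C / b) < 8 ^ k0" using real_arch_pow[of 8] by auto
  \<comment> \<open>Increasing \<open>j\<close> shrinks the radius and raises the minimal distance,
    so the families decrease and halves of pairs from \<open>A (Suc j)\<close> land in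
    \<open>A j\<close>.\<close>
  define A where "A j = slopes (N - j) (k0 + j)" for j
  define I where "I = (\<lambda>j. prod_encode (N - j, k0 + j)) ` {..N}"
  have fam: "slope_family (prod_encode (N - j, k0 + j)) = A j" for j
    by (simp add: slope_family_def A_def)
  have "asymptotic_gain slope_family M \<epsilon> \<gamma> I"
    unfolding asymptotic_gain_def
  proof (intro allI impI)
    fix u :: "'b \<Rightarrow> real" assume u: "linear u" and un: "\<forall>y. \<bar>u y\<bar> \<le> norm y"
    define \<sigma> where "\<sigma> j = (SUP s\<in>A j. u s)" for j
    have ub: "u s \<le> \<Lambda>" if "s \<in> A j" for s j
    proof -
      have "norm s \<le> \<Lambda>" using slope_norm_le that unfolding A_def \<Lambda>_def by blast
      then show ?thesis using un abs_le_D1 order_trans by blast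
    qed
    have A0: "0 \<in> A j" for j by (simp add: A_def slopes_def)
    have up: "u s \<le> \<sigma> j" if "s \<in> A j" for s j
      unfolding \<sigma>_def by (rule cSUP_upper[OF that bdd_aboveI2[OF ub]])
    have \<sigma>0: "0 \<le> \<sigma> j" for j using up[OF A0] linear_0[OF u] by simp
    have \<sigma>\<Lambda>: "\<sigma> j \<le> \<Lambda>" for j unfolding \<sigma>_def using A0 by (intro cSUP_least ub) auto
    obtain j where j: "j < N" "\<sigma> j - \<sigma> (Suc j) \<le> \<eta>"
      using small_drop[of \<sigma> \<Lambda> N \<eta>, OF \<sigma>\<Lambda> \<sigma>0 N] by blast
    have "\<exists>x y. admissible (8 ^ (N - Suc j) / c) (8 ^ (k0 + Suc j)) x y \<and> \<sigma> j - 2 * \<eta> \<le> u (slope x y)"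
    proof -
      have ne: "A (Suc j) \<noteq> {}" using A0 by blast
      have "\<exists>s\<in>A (Suc j). \<sigma> (Suc j) - \<eta> < u s"
        by (rule less_cSUP_iff[OF ne bdd_aboveI2[OF ub], THEN iffD1]) (use \<eta> in \<open>simp_all flip: \<sigma>_def\<close>)
      then obtain s where s: "s \<in> A (Suc j)" "\<sigma> (Suc j) - \<eta> < u s" by blast
      then have us: "\<sigma> j - 2 * \<eta> \<le> u s" using j by linarith
      show ?thesis
      proof (cases "s = 0")
        \<comment> \<open>The near-supremum may come from the added 0. Then
          \<open>\<sigma> j - 2 * \<eta> \<le> 0\<close>, and any admissible pair will do once
          oriented so that \<open>u\<close> is nonnegative on its slope.\<close>
        case True
        obtain x y where xy: "admissible (8 ^ (N - Suc j) / c) (8 ^ (k0 + Suc j)) x y"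
          using admissible_exists by blast
        have "u (slope y x) = - u (slope x y)" using linear_neg[OF u, of "slope x y"] by (simp add: slope_minus)
        then have "0 \<le> u (slope x y) \<or> 0 \<le> u (slope y x)" by linarith
        then show ?thesis using xy admissible_sym[OF xy] us linear_0[OF u] True by fastforce
      next
        case False
        then show ?thesis using s us unfolding A_def slopes_def by blast
      qed
    qed
    then obtain x y where ad: "admissible (8 ^ (N - Suc j) / c) (8 ^ (k0 + Suc j)) x y"
      and steep: "\<sigma> j - 2 * \<eta> \<le> u (slope x y)" by blast
    have Nj: "N - j = Suc (N - Suc j)" using j by simp
    have ad': "admissible (8 ^ (N - Suc j) / c) (8 * 8 ^ (k0 + j)) x y" using ad by simp
    define D where "D = p (x - y) / 2"
    define m where "m = (1/2) *\<^sub>R (x + y)"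
    define h where "h = (1/2) *\<^sub>R (x - y)"
    have D8: "8 ^ k0 \<le> D"
    proof -
      have "(8::real) ^ k0 \<le> 8 ^ (k0 + j)" by (rule power_increasing) auto
      moreover have "8 * 8 ^ (k0 + j) \<le> p (x - y)" using ad' by (simp only: admissible_def)
      moreover have "(0::real) \<le> 8 ^ (k0 + j)" by simp
      ultimately show ?thesis unfolding D_def by linarith
    qed
    have D: "0 < D" using D8 less_le_trans[of 0 "8 ^ k0" D] by simp
    have h: "p h = D" by (simp add: h_def D_def pD(3))
    \<comment> \<open>Gorelik's principle returns \<open>norm z \<le> 3 * r\<close>; the factor
      \<open>3 * C\<close> makes this \<open>p z \<le> b * D\<close>, the range of
      \<open>smooth_ball\<close>.\<close>
    define r where "r = b * D / (3 * C)"
    have r: "r0 \<le> r" "0 < r" "3 * C * r = b * D"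
    proof -
      show "0 < r" "3 * C * r = b * D" using b D C by (auto simp: r_def)
      have "r0 * (3 * C / b) \<le> D" using k0 D8 by linarith
      then show "r0 \<le> r" using b C by (simp add: r_def field_simps)
    qed
    have mr: "norm m \<le> K * r"
    proof -
      have "norm x \<le> 8 ^ (N - Suc j) / c * (2 * D)" "norm y \<le> 8 ^ (N - Suc j) / c * (2 * D)"
        using ad by (auto simp: admissible_def D_def)
      then have "norm m \<le> 8 ^ (N - Suc j) / c * (2 * D)"
      proof -
        have "norm m = norm (x + y) / 2" by (simp add: m_def)
        then have "norm m \<le> E" if "norm x \<le> E" "norm y \<le> E" for E
          using that norm_triangle_ineq[of x y] by linarith
        then show ?thesis using \<open>norm x \<le> 8 ^ (N - Suc j) / c * (2 * D)\<close>
            \<open>norm y \<le> 8 ^ (N - Suc j) / c * (2 * D)\<close> by blast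
      qed
      also have "\<dots> \<le> 8 ^ N / c * (2 * D)"
      proof -
        have "(8::real) ^ (N - Suc j) \<le> 8 ^ N" by (rule power_increasing) auto
        then have "(8::real) ^ (N - Suc j) / c \<le> 8 ^ N / c" by (rule divide_right_mono) (use c in simp)
        then show ?thesis by (rule mult_right_mono) (use D in simp)
      qed
      also have "\<dots> = K * r" using b C c by (simp add: K_def r_def)
      finally show ?thesis .
    qed
    obtain V where V: "V \<in> cof"
      and plus: "\<And>z. z \<in> V \<Longrightarrow> p z \<le> b * D \<Longrightarrow> p (h + z) \<le> (1 + \<theta> * b) * D"
      and minus: "\<And>z. z \<in> V \<Longrightarrow> p z \<le> b * D \<Longrightarrow> p (h - z) \<le> (1 + \<theta> * b) * D"
      using smooth_ball[OF b(1) less_imp_le[OF \<theta>(1)] _ h D] sm by metis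
    obtain F where F: "finite F" and gorF: "\<And>v. norm v \<le> r / (8 * L) \<Longrightarrow>
      \<exists>z\<in>V. norm z \<le> 3 * r \<and> (\<exists>t\<in>F. norm (f (m + z) - (t + v)) \<le> \<zeta> * r)"
      using gor[OF r(1) mr V] by blast
    define \<delta> where "\<delta> = \<beta> * b * D / 8"
    have \<delta>: "0 < \<delta>" using \<beta> b D by (simp add: \<delta>_def)
    \<comment> \<open>The test set \<open>insert (f x) F\<close> and \<delta> are fixed before
      \<phi> and \<open>v\<close>: they come from \<open>u\<close> through the pair
      \<open>x\<close>, \<open>y\<close>.\<close>
    have gain: "\<exists>s\<in>A j. \<forall>s'\<in>A j. u s' + \<gamma> \<le> \<phi> s"
      if \<phi>: "linear \<phi>" and \<phi>n: "\<forall>y. \<bar>\<phi> y\<bar> \<le> norm y" and v: "norm v \<le> M" and uv: "u v = 0" and \<phi>v: "\<epsilon> \<le> \<phi> v"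
        and near: "\<forall>t\<in>insert (f x) F. \<bar>\<phi> t - u t\<bar> < \<delta>" for \<phi> v
    proof -
      \<comment> \<open>The minus sign lowers \<phi> at \<open>f q\<close> and thereby raises
        \<open>\<phi> (f x - f q)\<close>.\<close>
      define w where "w = - (\<kappa> * r) *\<^sub>R v"
      have "norm w \<le> r / (8 * L)"
      proof -
        have "norm w \<le> \<kappa> * r * M" using v \<kappa> r by (simp add: w_def)
        also have "\<dots> = r / (8 * L)" using M by (simp add: \<kappa>_def)
        finally show ?thesis .
      qed
      then obtain z t where z: "z \<in> V" "norm z \<le> 3 * r" and t: "t \<in> F" "norm (f (m + z) - (t + w)) \<le> \<zeta> * r"
        using gorF by blast
      have pz: "p z \<le> b * D"
      proof -
        have "C * norm z \<le> C * (3 * r)" using z C by (intro mult_left_mono) auto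
        then show ?thesis using p_upper[of z] r(3) by simp
      qed
      define q where "q = m + z"
      have R: "1 / c \<le> 8 ^ (N - Suc j) / c" using c by (intro divide_right_mono) auto
      have eqR: "8 * (8 ^ (N - Suc j) / c) = 8 ^ (N - j) / c" by (simp add: Nj)
      have adq: "admissible (8 ^ (N - j) / c) (8 ^ (k0 + j)) x q" "admissible (8 ^ (N - j) / c) (8 ^ (k0 + j)) q y"
        using admissible_midpoint[OF ad' _ R D_def pz] b unfolding eqR q_def m_def by auto
      have inA: "slope x q \<in> A j" "slope q y \<in> A j" using adq unfolding A_def slopes_def by blast+
      have hxy: "x - q = h - z" "q - y = h + z"
        unfolding q_def m_def h_def
        by (simp_all add: algebra_simps flip: scaleR_add_left scaleR_diff_left)
      have P: "p (x - q) \<le> (1 + \<theta> * b) * D" "p (q - y) \<le> (1 + \<theta> * b) * D"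
        unfolding hxy using plus minus z(1) pz by auto
      have pos: "0 < p (x - q)" "0 < p (q - y)" "0 < p (x - y)"
        using adq D zero_less_power[of "8::real" "k0 + j"] unfolding admissible_def D_def by linarith+
      have slope_eq: "\<psi> (f a - f a') = \<psi> (slope a a') * p (a - a')" if "linear \<psi>" "0 < p (a - a')"
        for \<psi> :: "'b \<Rightarrow> real" and a a'
        using that by (simp add: slope_def linear_scale)
      have "u (f q - f y) \<le> \<sigma> j * ((1 + \<theta> * b) * D)"
        unfolding slope_eq[OF u pos(2)]
        using up[OF inA(2)] P(2) \<sigma>0 pos(2) by (intro mult_mono) auto
      moreover have "(\<sigma> j - 2 * \<eta>) * (2 * D) \<le> u (f x - f y)"
        unfolding slope_eq[OF u pos(3)] using steep D by (simp add: D_def mult_right_mono)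
      moreover have "u (f x - f q) = u (f x - f y) - u (f q - f y)" by (simp add: linear_diff[OF u])
      ultimately have low: "(\<sigma> j - 2 * \<eta>) * (2 * D) - \<sigma> j * ((1 + \<theta> * b) * D) \<le> u (f x - f q)" by linarith
      \<comment> \<open>Of the effect \<open>\<beta> * b * D\<close>, a quarter covers the error
        \<zeta> and a quarter the two deviations \<delta>; half is left.\<close>
      have "\<beta> * b * D / 2 \<le> \<phi> (f x - f q) - u (f x - f q)"
      proof -
        define e where "e = f q - (t + w)"
        have fq: "f q = t + w + e" by (simp add: e_def)
        have \<phi>q: "\<phi> (f q) = \<phi> t + \<phi> w + \<phi> e" by (metis fq linear_add[OF \<phi>])
        have uq: "u (f q) = u t + u w + u e" by (metis fq linear_add[OF u])
        have e: "norm e \<le> \<zeta> * r" using t(2) by (simp add: e_def q_def)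
        have "\<bar>\<phi> e\<bar> \<le> norm e" "\<bar>u e\<bar> \<le> norm e" using \<phi>n un by blast+
        then have "\<phi> e - u e \<le> 2 * (\<zeta> * r)" using e by linarith
        moreover have "\<phi> w \<le> - (\<kappa> * r * \<epsilon>)"
        proof -
          have "\<kappa> * r * \<epsilon> \<le> \<kappa> * r * \<phi> v" using \<phi>v \<kappa> r by (intro mult_left_mono) auto
          then show ?thesis unfolding w_def linear_scale[OF \<phi>] by simp
        qed
        moreover have "u w = 0" unfolding w_def linear_scale[OF u] using uv by simp
        moreover have "\<bar>\<phi> t - u t\<bar> < \<delta>" "\<bar>\<phi> (f x) - u (f x)\<bar> < \<delta>" using near t(1) by auto
        moreover have "\<kappa> * r * \<epsilon> = \<beta> * b * D" using C r(3) by (simp add: \<beta>_def r_def)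
        moreover have "2 * (\<zeta> * r) = \<kappa> * r * \<epsilon> / 4" by (simp add: \<zeta>_def)
        ultimately show ?thesis
          unfolding linear_diff[OF \<phi>] linear_diff[OF u] \<phi>q uq \<delta>_def by linarith
      qed
      then have "(\<sigma> j - 2 * (\<beta> * b / 32)) * (2 * D) - \<sigma> j * ((1 + \<theta> * b) * D) + \<beta> * b * D / 2 \<le> \<phi> (f x - f q)"
        using low unfolding \<eta>_def by linarith
      moreover have "\<sigma> j * \<theta> \<le> \<beta> / 16"
        using mult_right_mono[OF \<sigma>\<Lambda>[of j], of \<theta>] \<theta> by linarith
      ultimately have "(\<sigma> j + \<gamma>) * p (x - q) \<le> \<phi> (slope x q) * p (x - q)"
        unfolding \<gamma>_def slope_eq[OF \<phi> pos(1), symmetric]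
        using \<sigma>0[of j] \<theta> b \<beta> D P(1) by (intro gain_arithmetic[of "\<sigma> j" \<theta> \<beta> b D]) auto
      then have "\<sigma> j + \<gamma> \<le> \<phi> (slope x q)" using pos(1) by simp
      then show ?thesis using inA(1) up by (intro bexI[of _ "slope x q"]) (force intro: order_trans)+
    qed
    show "\<exists>i\<in>I. \<exists>T \<delta>. finite T \<and> 0 < \<delta> \<and>
       (\<forall>\<phi> v. linear \<phi> \<longrightarrow> (\<forall>y. \<bar>\<phi> y\<bar> \<le> norm y) \<longrightarrow> norm v \<le> M \<longrightarrow> u v = 0 \<longrightarrow> \<epsilon> \<le> \<phi> v \<longrightarrow>
         (\<forall>t\<in>T. \<bar>\<phi> t - u t\<bar> < \<delta>) \<longrightarrow> (\<exists>s\<in>slope_family i. \<forall>s'\<in>slope_family i. u s' + \<gamma> \<le> \<phi> s))"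
    proof (rule bexI[of _ "prod_encode (N - j, k0 + j)"], intro exI conjI)
      show "finite (insert (f x) F)" using F by simp
      show "0 < \<delta>" by (rule \<delta>)
      show "\<forall>\<phi> v. linear \<phi> \<longrightarrow> (\<forall>y. \<bar>\<phi> y\<bar> \<le> norm y) \<longrightarrow> norm v \<le> M \<longrightarrow> u v = 0 \<longrightarrow> \<epsilon> \<le> \<phi> v \<longrightarrow>
         (\<forall>t\<in>insert (f x) F. \<bar>\<phi> t - u t\<bar> < \<delta>) \<longrightarrow>
         (\<exists>s\<in>slope_family (prod_encode (N - j, k0 + j)). \<forall>s'\<in>slope_family (prod_encode (N - j, k0 + j)). u s' + \<gamma> \<le> \<phi> s)"
        unfolding fam using gain by blast
      show "prod_encode (N - j, k0 + j) \<in> I" using j by (auto simp: I_def)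
    qed
  qed
  then show ?thesis using \<gamma> by (intro exI[of _ \<gamma>] conjI exI[of _ I]) (auto simp: I_def)
qed

lemma target_renorming:
  "\<exists>N :: 'b \<Rightarrow> real. equivalent_norm N \<and> AUS N"
proof -
  have zero: "0 \<in> slope_family i" for i by (simp add: slope_family_def slopes_def split: prod.split)
  have sym: "- s \<in> slope_family i" if "s \<in> slope_family i" for i s
    using that slopes_minus by (simp add: slope_family_def split: prod.splits)
  have bound: "norm s \<le> L / c + L" if "s \<in> slope_family i" for i s
    using that slope_norm_le by (simp add: slope_family_def split: prod.splits)
  have "0 \<le> L / c" using L c by simp
  then have "0 < 1 + 2 * (L / c + L)" using L
    by (intro add_pos_nonneg mult_nonneg_nonneg add_nonneg_nonneg) auto
  note pos = this
  have "equivalent_norm (polar_norm (weighted_sums slope_family))"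
    by (rule asymptotic_gain_AUS(1)[of slope_family "L / c + L"])
       (rule zero sym bound slope_family_gain pos | assumption)+
  moreover have "AUS (polar_norm (weighted_sums slope_family))"
    by (rule asymptotic_gain_AUS(2)[of slope_family "L / c + L"])
       (rule zero sym bound slope_family_gain pos | assumption)+
  ultimately show ?thesis by blast
qed

end

theorem corollary3:
  assumes "asymptotically_coarse_lipschitz_equivalent TYPE('a::banach) TYPE('b::banach)"
    and "AUSable TYPE('a)"
  shows "AUSable TYPE('b)"
proof -
  obtain f :: "'a \<Rightarrow> 'b" and g :: "'b \<Rightarrow> 'a" where fg: "coarse_lipschitz f" "coarse_lipschitz g"
    and close: "asymptotically_close (g \<circ> f) id" "asymptotically_close (f \<circ> g) id"
    using assms(1) unfolding asymptotically_coarse_lipschitz_equivalent_def by blast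
  obtain L where L: "1 \<le> L" "\<And>x y. norm (f x - f y) \<le> L * norm (x - y) + L"
    "\<And>x y. norm (g x - g y) \<le> L * norm (x - y) + L"
    using coarse_lipschitz_const[OF fg] by blast
  interpret asymptotic_equivalence f g L by unfold_locales (use L close in auto)
  obtain p :: "'a \<Rightarrow> real" where p: "equivalent_norm p" "AUS p" using assms(2) unfolding AUSable_def by blast
  then obtain c C where cC: "0 < c" "0 < C" "\<And>x. c * norm x \<le> p x" "\<And>x. p x \<le> C * norm x"
    unfolding equivalent_norm_def by blast
  have "\<exists>N :: 'b \<Rightarrow> real. equivalent_norm N \<and> AUS N"
  proof (cases "\<exists>x::'a. x \<noteq> 0")
    case True
    interpret smooth_source f g L p c C by unfold_locales (use p cC True in auto)
    show ?thesis by (rule target_renorming)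
  next
    \<comment> \<open>If the source is trivial, \<open>g\<close> is constant, and closeness of
      \<open>f \<circ> g\<close> to the identity bounds the norm on the target, which is then
      trivial too.\<close>
    case False
    then have g0: "g y = 0" for y :: 'b by blast
    obtain R where R: "\<And>y. norm (f (g y) - y) \<le> 1/2 * norm y + R" using fg_bound[of "1/2"] by auto
    have bounded: "norm y \<le> 2 * (R + norm (f 0))" for y :: 'b
      using R[of y] norm_triangle_ineq2[of y "f 0"] by (simp add: g0 norm_minus_commute)
    have zero: "y = 0" for y :: 'b
    proof (rule ccontr)
      assume "y \<noteq> 0"
      then obtain n :: nat where "2 * (R + norm (f 0)) < real n * norm y" using reals_Archimedean3[of "norm y"] by auto
      then show False using bounded[of "real n *\<^sub>R y"] by simp
    qed
    have "equivalent_norm (norm :: 'b \<Rightarrow> real)"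
      by (auto simp: equivalent_norm_def is_norm_def norm_triangle_ineq intro!: exI[of _ 1])
    moreover have "AUS (norm :: 'b \<Rightarrow> real)"
    proof (rule AUS_I[OF calculation])
      fix \<epsilon> :: real
      have "norm x \<noteq> 1" for x :: 'b using zero[of x] by simp
      then show "\<exists>t0>0. \<forall>\<tau>. 0 < \<tau> \<longrightarrow> \<tau> < t0 \<longrightarrow> (\<forall>x::'b. norm x = 1 \<longrightarrow>
        (\<exists>Y\<in>cof. \<forall>v\<in>Y. norm v = 1 \<longrightarrow> norm (x + \<tau> *\<^sub>R v) \<le> 1 + \<epsilon> * \<tau>))"
        by (intro exI[of _ 1]) simp
    qed
    ultimately show ?thesis by blast
  qed
  then show ?thesis by (simp add: AUSable_def)
qed

end
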